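(* The $\mathbb{Z}$-linear map $F:\mathcal{M}at\to\mathcal{QS}ym$ defined on basis elements by $[M]\mapsto F(M,\mathbf{x})$ is a morphism of Hopf algebras.
   Context: For a matroid $M$ on finite ground set $E$ with bases $\mathcal{B}(M)$, and $f:E\to\mathbb{P}=\{1,2,\ldots\}$, call $f$ $M$-generic if the minimum of $f(B)=\sum_{e\in B}f(e)$ over bases $B$ is attained by a unique base, and set $F(M,\mathbf{x})=\sum_{f\ M\text{-generic}}\prod_{e\in E}x_{f(e)}$ (for $E=\emptyset$ this is $1$). $\mathcal{M}at$ is the free $\mathbb{Z}$-module with basis $[M]$ indexed by isomorphism classes of matroids, graded by $|E|$, with product $[M_1]\cdot[M_2]=[M_1\oplus M_2]$ (direct sum), unit the class of the empty matroid, counit the projection to degree $0$, and coproduct $\Delta[M]=\sum_{A\subseteq E}[M|_A]\otimes[M/A]$, where $M|_A$ is the restriction to $A$ and $M/A$ the contraction by $A$; this is a graded connected Hopf algebra. $\mathcal{QS}ym$ is the Hopf algebra over $\mathbb{Z}$ of quasisymmetric functions in $x_1,x_2,\ldots$ (bounded-degree power series in which, for each composition $(\alpha_1,\ldots,\alpha_k)$, the coefficient of $x_{i_1}^{\alpha_1}\cdots x_{i_k}^{\alpha_k}$ is independent of $i_1<\cdots<i_k$), graded by degree, with the usual product of power series. Its coproduct is defined as follows: a quasisymmetric $g(\mathbf{x})$ determines a unique quasisymmetric $g(\mathbf{x},\mathbf{y})$ in the linearly ordered variables $x_1<x_2<\cdots<y_1<y_2<\cdots$ with $g(\mathbf{x},\mathbf{0})=g(\mathbf{x})$;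 writing uniquely $g(\mathbf{x},\mathbf{y})=\sum_i g_i(\mathbf{x})h_i(\mathbf{y})$ with $g_i,h_i$ quasisymmetric, set $\Delta g=\sum_i g_i\otimes h_i$. *)

theory Defs
  imports Complex_Main "HOL-Library.FuncSet" "HOL-Library.Poly_Mapping"
    "HOL-Computational_Algebra.Group_Closure"
begin

definition int_scale :: "int \<Rightarrow> 'a \<Rightarrow> 'a::ab_group_add"
  where "int_scale k a = (\<Sum>i<nat k. a) - (\<Sum>i<nat (- k). a)"

lemma int_scale_0 [simp]: "int_scale 0 a = 0"
  and int_scale_1 [simp]: "int_scale 1 a = a"
  and int_scale_minus: "int_scale (- k) a = - int_scale k a"
  by (simp_all add: int_scale_def)

lemma int_scale_step: "int_scale (k + 1) a = int_scale k a + a"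
proof (cases "k \<ge> 0")
  case True
  then have "nat (k + 1) = Suc (nat k)" by simp
  with True show ?thesis by (simp add: int_scale_def)
next
  case False
  then have "nat (- k) = Suc (nat (- (k + 1)))" by simp
  with False show ?thesis by (simp add: int_scale_def)
qed

lemma int_scale_add: "int_scale (j + k) a = int_scale j a + int_scale k a"
proof (induction k rule: int_induct [where k = 0])
  case base
  show ?case by simp
next
  case (step1 i)
  then show ?case using int_scale_step [of "j + i" a] int_scale_step [of i a]
    by (simp add: algebra_simps)
next
  case (step2 i)
  then show ?case using int_scale_step [of "j + i - 1" a] int_scale_step [of "i - 1" a]
    by (simp add: algebra_simps)
qed

text \<open>The \<open>\<int>\<close>-linear extension of \<open>f\<close> to the free \<open>\<int>\<close>-module \<open>'k \<Rightarrow>\<^sub>0 int\<close> with basis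
  \<open>frag_of k\<close>.\<close>

definition free_extend :: "('k \<Rightarrow> 'a) \<Rightarrow> ('k \<Rightarrow>\<^sub>0 int) \<Rightarrow> 'a::ab_group_add"
  where "free_extend f p = (\<Sum>k\<in>Poly_Mapping.keys p. int_scale (Poly_Mapping.lookup p k) (f k))"

lemma free_extend_superset:
  assumes "finite S" "Poly_Mapping.keys p \<subseteq> S"
  shows "free_extend f p = (\<Sum>k\<in>S. int_scale (Poly_Mapping.lookup p k) (f k))"
  unfolding free_extend_def using assms
  by (intro sum.mono_neutral_left) (auto simp: in_keys_iff)

lemma free_extend_add: "free_extend f (p + q) = free_extend f p + free_extend f q"
proof -
  let ?S = "Poly_Mapping.keys p \<union> Poly_Mapping.keys q"
  show ?thesis using Poly_Mapping.keys_add [of p q]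
    by (simp add: free_extend_superset [of ?S] lookup_add int_scale_add sum.distrib)
qed

interpretation free_extend: additive "free_extend f"
  by standard (rule free_extend_add)

lemma free_extend_of [simp]: "free_extend f (frag_of k) = f k"
  by (simp add: free_extend_def)

text \<open>The tensor product over \<open>\<int>\<close>: since every additive map is \<open>\<int>\<close>-linear, it is the quotient of the free
  module on pairs by the biadditivity relations alone.\<close>

definition tensor_relations :: "('a::ab_group_add \<times> 'b::ab_group_add \<Rightarrow>\<^sub>0 int) set"
  where "tensor_relations =
    {frag_of (a + a', b) - frag_of (a, b) - frag_of (a', b) | a a' b. True} \<union>
    {frag_of (a, b + b') - frag_of (a, b) - frag_of (a, b') | a b b'. True}"

definition tensor_rel ::
    "('a::ab_group_add \<times> 'b::ab_group_add \<Rightarrow>\<^sub>0 int) \<Rightarrow> ('a \<times> 'b \<Rightarrow>\<^sub>0 int) \<Rightarrow> bool"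
  where "tensor_rel p q \<longleftrightarrow> p - q \<in> group_closure tensor_relations"

quotient_type (overloaded) ('a, 'b) tensor =
    "'a::ab_group_add \<times> 'b::ab_group_add \<Rightarrow>\<^sub>0 int" / tensor_rel
proof (rule equivpI)
  show "reflp tensor_rel" by (simp add: reflp_def tensor_rel_def)
  show "symp tensor_rel"
    unfolding symp_def tensor_rel_def by (metis group_closure_minus_iff minus_diff_eq)
  show "transp tensor_rel"
    unfolding transp_def tensor_rel_def using group_closure_add by fastforce
qed

instantiation tensor :: (ab_group_add, ab_group_add) ab_group_add
begin

lift_definition zero_tensor :: "('a, 'b) tensor" is 0 .

lift_definition plus_tensor :: "('a, 'b) tensor \<Rightarrow> ('a, 'b) tensor \<Rightarrow> ('a, 'b) tensor" is "(+)"
  unfolding tensor_rel_def by (metis add_diff_add group_closure_add)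

lift_definition uminus_tensor :: "('a, 'b) tensor \<Rightarrow> ('a, 'b) tensor" is uminus
proof -
  fix p p' :: "'a \<times> 'b \<Rightarrow>\<^sub>0 int"
  assume "tensor_rel p p'"
  moreover have "- p - - p' = - (p - p')" by simp
  ultimately show "tensor_rel (- p) (- p')"
    unfolding tensor_rel_def by (metis group_closure_minus_iff)
qed

lift_definition minus_tensor :: "('a, 'b) tensor \<Rightarrow> ('a, 'b) tensor \<Rightarrow> ('a, 'b) tensor" is "(-)"
proof -
  fix p p' q q' :: "'a \<times> 'b \<Rightarrow>\<^sub>0 int"
  assume "tensor_rel p p'" "tensor_rel q q'"
  moreover have "p - q - (p' - q') = (p - p') - (q - q')" by simp
  ultimately show "tensor_rel (p - q) (p' - q')"
    unfolding tensor_rel_def by (metis group_closure.diff)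
qed

instance
  by standard (transfer, simp add: tensor_rel_def algebra_simps)+

end

lift_definition pure_tensor :: "'a::ab_group_add \<Rightarrow> 'b::ab_group_add \<Rightarrow> ('a, 'b) tensor"
    (infix \<open>\<otimes>\<close> 75)
  is "\<lambda>a b. frag_of (a, b)" .

lemma pure_tensor_add_left: "(a + a') \<otimes> b = a \<otimes> b + a' \<otimes> b"
  unfolding pure_tensor.abs_eq plus_tensor.abs_eq tensor.abs_eq_iff tensor_rel_def
    tensor_relations_def diff_diff_add [symmetric]
  by (rule group_closure.base) blast

lemma pure_tensor_add_right: "a \<otimes> (b + b') = a \<otimes> b + a \<otimes> b'"
  unfolding pure_tensor.abs_eq plus_tensor.abs_eq tensor.abs_eq_iff tensor_rel_def
    tensor_relations_def diff_diff_add [symmetric]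
  by (rule group_closure.base) blast

definition biadditive :: "('a::ab_group_add \<Rightarrow> 'b::ab_group_add \<Rightarrow> 'c::ab_group_add) \<Rightarrow> bool"
  where "biadditive \<beta> \<longleftrightarrow> (\<forall>b. additive (\<lambda>a. \<beta> a b)) \<and> (\<forall>a. additive (\<beta> a))"

text \<open>The induced map on the tensor product. It is independent of the chosen representative
  only for biadditive \<open>\<beta>\<close>.\<close>

definition tensor_lift ::
    "('a::ab_group_add \<Rightarrow> 'b::ab_group_add \<Rightarrow> 'c::ab_group_add) \<Rightarrow> ('a, 'b) tensor \<Rightarrow> 'c"
  where "tensor_lift \<beta> t = free_extend (\<lambda>(a, b). \<beta> a b) (rep_tensor t)"

lemma free_extend_tensor_relations:
  assumes \<beta>: "biadditive \<beta>" and "p \<in> group_closure tensor_relations"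
  shows "free_extend (\<lambda>(a, b). \<beta> a b) p = 0"
  using assms(2)
proof induction
  case (base s)
  have "\<beta> (a + a') b = \<beta> a b + \<beta> a' b" "\<beta> a (b + b') = \<beta> a b + \<beta> a b'" for a a' b b'
    using \<beta> by (auto simp: biadditive_def additive_def)
  with base show ?case
    by (auto simp: tensor_relations_def free_extend.diff free_extend.zero)
next
  case (diff s t)
  then show ?case by (simp add: free_extend.diff)
qed

lemma tensor_lift_abs:
  assumes "biadditive \<beta>"
  shows "tensor_lift \<beta> (abs_tensor p) = free_extend (\<lambda>(a, b). \<beta> a b) p"
proof -
  have "tensor_rel (rep_tensor (abs_tensor p)) p"
    by (meson Quotient3_tensor rep_abs_rsp_left tensor.abs_eq_iff Quotient3_rel_rep Quotient3_abs_rep)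
  then have "free_extend (\<lambda>(a, b). \<beta> a b) (rep_tensor (abs_tensor p) - p) = 0"
    using assms by (simp add: free_extend_tensor_relations tensor_rel_def)
  then show ?thesis by (simp add: tensor_lift_def free_extend.diff)
qed

lemma tensor_lift_pure [simp]: "biadditive \<beta> \<Longrightarrow> tensor_lift \<beta> (a \<otimes> b) = \<beta> a b"
  by (simp add: pure_tensor.abs_eq tensor_lift_abs)

lemma additive_tensor_lift:
  assumes "biadditive \<beta>"
  shows "additive (tensor_lift \<beta>)"
proof
  fix s t
  show "tensor_lift \<beta> (s + t) = tensor_lift \<beta> s + tensor_lift \<beta> t"
  proof (induction s; induction t)
    fix p q
    show "tensor_lift \<beta> (abs_tensor q + abs_tensor p)
        = tensor_lift \<beta> (abs_tensor q) + tensor_lift \<beta> (abs_tensor p)"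
      using assms by (simp add: plus_tensor.abs_eq tensor_lift_abs free_extend_add)
  qed
qed

definition tensor_map ::
    "('a::ab_group_add \<Rightarrow> 'c::ab_group_add) \<Rightarrow> ('b::ab_group_add \<Rightarrow> 'd::ab_group_add)
      \<Rightarrow> ('a, 'b) tensor \<Rightarrow> ('c, 'd) tensor"
  where "tensor_map \<phi> \<psi> = tensor_lift (\<lambda>a b. \<phi> a \<otimes> \<psi> b)"

lemma biadditive_tensor_map:
  "additive \<phi> \<Longrightarrow> additive \<psi> \<Longrightarrow> biadditive (\<lambda>a b. \<phi> a \<otimes> \<psi> b)"
  by (auto simp: biadditive_def additive_def pure_tensor_add_left pure_tensor_add_right)

lemma tensor_map_pure [simp]:
  "additive \<phi> \<Longrightarrow> additive \<psi> \<Longrightarrow> tensor_map \<phi> \<psi> (a \<otimes> b) = \<phi> a \<otimes> \<psi> b"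
  by (simp add: tensor_map_def biadditive_tensor_map)

definition tensor_mult :: "('a::ring, 'a) tensor \<Rightarrow> 'a"
  where "tensor_mult = tensor_lift (*)"

lemma tensor_mult_pure [simp]: "tensor_mult (a \<otimes> b) = a * b"
proof -
  have "biadditive ((*) :: 'a \<Rightarrow> 'a \<Rightarrow> 'a)"
    by (simp add: biadditive_def additive_def distrib_left distrib_right)
  then show ?thesis by (simp add: tensor_mult_def)
qed

text \<open>Below, \<open>\<Delta>\<close> and \<open>\<epsilon>\<close> are the comultiplication and counit of a Hopf algebra over \<open>\<int>\<close> whose underlying
  ring is given by the type; its unit map is \<open>of_int\<close>.\<close>

definition is_antipode ::
    "('a::ring_1 \<Rightarrow> ('a, 'a) tensor) \<Rightarrow> ('a \<Rightarrow> int) \<Rightarrow> ('a \<Rightarrow> 'a) \<Rightarrow> bool"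
  where "is_antipode \<Delta> \<epsilon> S \<longleftrightarrow> additive S \<and>
    (\<forall>a. tensor_mult (tensor_map S (\<lambda>x. x) (\<Delta> a)) = of_int (\<epsilon> a)) \<and>
    (\<forall>a. tensor_mult (tensor_map (\<lambda>x. x) S (\<Delta> a)) = of_int (\<epsilon> a))"

text \<open>An antipode is unique when it exists, so quantifying over antipodes amounts to
  \<open>\<phi> \<circ> S = S' \<circ> \<phi>\<close> for the antipodes \<open>S\<close>, \<open>S'\<close> of the two Hopf algebras.\<close>

definition hopf_morphism ::
    "('a::ring_1 \<Rightarrow> ('a, 'a) tensor) \<Rightarrow> ('a \<Rightarrow> int) \<Rightarrow>
     ('b::ring_1 \<Rightarrow> ('b, 'b) tensor) \<Rightarrow> ('b \<Rightarrow> int) \<Rightarrow> ('a \<Rightarrow> 'b) \<Rightarrow> bool"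
  where "hopf_morphism \<Delta> \<epsilon> \<Delta>' \<epsilon>' \<phi> \<longleftrightarrow>
    additive \<phi> \<and>
    \<phi> 1 = 1 \<and> (\<forall>a b. \<phi> (a * b) = \<phi> a * \<phi> b) \<and>
    (\<forall>a. \<epsilon>' (\<phi> a) = \<epsilon> a) \<and> (\<forall>a. \<Delta>' (\<phi> a) = tensor_map \<phi> \<phi> (\<Delta> a)) \<and>
    (\<forall>S S'. is_antipode \<Delta> \<epsilon> S \<longrightarrow> is_antipode \<Delta>' \<epsilon>' S' \<longrightarrow> (\<forall>a. \<phi> (S a) = S' (\<phi> a)))"

type_synonym 'v monomial = "'v \<Rightarrow>\<^sub>0 nat"

definition mdegree :: "'v monomial \<Rightarrow> nat"
  where "mdegree m = (\<Sum>v\<in>Poly_Mapping.keys m. Poly_Mapping.lookup m v)"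

lemma mdegree_superset:
  assumes "finite S" "Poly_Mapping.keys m \<subseteq> S"
  shows "mdegree m = (\<Sum>v\<in>S. Poly_Mapping.lookup m v)"
  unfolding mdegree_def using assms
  by (intro sum.mono_neutral_left) (auto simp: in_keys_iff)

lemma mdegree_add: "mdegree (m + n) = mdegree m + mdegree n"
proof -
  let ?S = "Poly_Mapping.keys m \<union> Poly_Mapping.keys n"
  show ?thesis using Poly_Mapping.keys_add [of m n]
    by (simp add: mdegree_superset [of ?S] lookup_add sum.distrib)
qed

lemma mdegree_0 [simp]: "mdegree 0 = 0"
  by (simp add: mdegree_def)

lemma mdegree_single [simp]: "mdegree (Poly_Mapping.single v k) = k"
  by (simp add: mdegree_def)

definition monom_splits :: "'v monomial \<Rightarrow> ('v monomial \<times> 'v monomial) set"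
  where "monom_splits m = {(a, b). a + b = m}"

lemma finite_monom_splits [simp]: "finite (monom_splits (m :: 'v monomial))"
proof -
  let ?K = "Poly_Mapping.keys m"
  let ?r = "\<lambda>a :: 'v monomial. restrict (Poly_Mapping.lookup a) ?K"
  let ?A = "fst ` monom_splits m"
  have keys: "Poly_Mapping.keys a \<subseteq> ?K" and le: "Poly_Mapping.lookup a v \<le> Poly_Mapping.lookup m v"
    if "a \<in> ?A" for a v
  proof -
    from that obtain b where b: "a + b = m" by (auto simp: monom_splits_def)
    then show "Poly_Mapping.lookup a v \<le> Poly_Mapping.lookup m v" by (auto simp: lookup_add)
    from b show "Poly_Mapping.keys a \<subseteq> ?K" by (auto simp: in_keys_iff lookup_add)
  qed
  have "inj_on ?r ?A"
  proof (rule inj_onI, rule poly_mapping_eqI)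
    fix a b v assume ab: "a \<in> ?A" "b \<in> ?A" "?r a = ?r b"
    show "Poly_Mapping.lookup a v = Poly_Mapping.lookup b v"
    proof (cases "v \<in> ?K")
      case True
      then show ?thesis using fun_cong [OF ab(3), of v] by simp
    next
      case False
      then show ?thesis using keys ab(1,2) by (metis in_keys_iff subsetD)
    qed
  qed
  moreover have "?r ` ?A \<subseteq> (\<Pi>\<^sub>E v\<in>?K. {..Poly_Mapping.lookup m v})"
    using le by (simp add: PiE_iff image_subset_iff)
  then have "finite (?r ` ?A)"
    by (rule finite_subset) (auto intro: finite_PiE)
  ultimately have "finite ?A" by (rule finite_imageD [rotated])
  moreover have "inj_on fst (monom_splits m)"
    by (auto simp: inj_on_def monom_splits_def)
  ultimately show ?thesis by (rule finite_imageD)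
qed

typedef 'v power_series = "UNIV :: ('v monomial \<Rightarrow> int) set"
  morphisms coeff Abs_power_series ..

setup_lifting type_definition_power_series

lemma power_series_eqI: "(\<And>m. coeff f m = coeff g m) \<Longrightarrow> f = g"
  by (simp add: coeff_inject [symmetric] ext)

instantiation power_series :: (type) comm_ring_1
begin

lift_definition zero_power_series :: "'a power_series" is "\<lambda>m. 0" .
lift_definition one_power_series :: "'a power_series" is "\<lambda>m. if m = 0 then 1 else 0" .
lift_definition plus_power_series :: "'a power_series \<Rightarrow> 'a power_series \<Rightarrow> 'a power_series"
  is "\<lambda>f g m. f m + g m" .
lift_definition uminus_power_series :: "'a power_series \<Rightarrow> 'a power_series"
  is "\<lambda>f m. - f m" .
lift_definition minus_power_series :: "'a power_series \<Rightarrow> 'a power_series \<Rightarrow> 'a power_series"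
  is "\<lambda>f g m. f m - g m" .
lift_definition times_power_series :: "'a power_series \<Rightarrow> 'a power_series \<Rightarrow> 'a power_series"
  is "\<lambda>f g m. \<Sum>(a, b)\<in>monom_splits m. f a * g b" .

instance
proof
  fix f g h :: "'a power_series"
  show "f * g * h = f * (g * h)"
  proof (transfer, rule ext)
    fix f g h :: "'a monomial \<Rightarrow> int" and m :: "'a monomial"
    have "(\<Sum>(a, b)\<in>monom_splits m. (\<Sum>(c, d)\<in>monom_splits a. f c * g d) * h b)
        = (\<Sum>((a, b), (c, d))\<in>Sigma (monom_splits m) (\<lambda>(a, b). monom_splits a). f c * g d * h b)"
      by (subst sum.Sigma [symmetric])
        (auto simp: sum_distrib_right split_def)
    also have "\<dots> = (\<Sum>((a, b), (c, d))\<in>Sigma (monom_splits m) (\<lambda>(a, b). monom_splits b).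
        f a * (g c * h d))"
      by (rule sum.reindex_bij_witness [where
            i = "\<lambda>((a, b), (c, d)). ((a + c, d), (a, c))" and
            j = "\<lambda>((a, b), (c, d)). ((c, d + b), (d, b))"])
        (auto simp: monom_splits_def algebra_simps)
    also have "\<dots> = (\<Sum>(a, b)\<in>monom_splits m. f a * (\<Sum>(c, d)\<in>monom_splits b. g c * h d))"
      by (subst sum.Sigma [symmetric])
        (auto simp: sum_distrib_left split_def)
    finally show "(\<Sum>(a, b)\<in>monom_splits m. (\<Sum>(c, d)\<in>monom_splits a. f c * g d) * h b)
      = (\<Sum>(a, b)\<in>monom_splits m. f a * (\<Sum>(c, d)\<in>monom_splits b. g c * h d))" .
  qed
  show "f * g = g * f"
  proof (transfer, rule ext)
    fix f g :: "'a monomial \<Rightarrow> int" and m :: "'a monomial"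
    show "(\<Sum>(a, b)\<in>monom_splits m. f a * g b) = (\<Sum>(a, b)\<in>monom_splits m. g a * f b)"
      by (rule sum.reindex_bij_witness [where i = prod.swap and j = prod.swap])
        (auto simp: monom_splits_def algebra_simps)
  qed
  show "1 * f = f"
  proof (transfer, rule ext)
    fix f :: "'a monomial \<Rightarrow> int" and m :: "'a monomial"
    have "(\<Sum>(a, b)\<in>monom_splits m. (if a = 0 then 1 else 0) * f b)
        = (\<Sum>(a, b)\<in>{(0 :: 'a monomial, m)}. (if a = 0 then 1 else 0) * f b)"
    proof (rule sum.mono_neutral_right)
      show "\<forall>i\<in>monom_splits m - {(0, m)}. (case i of (a, b) \<Rightarrow> (if a = 0 then 1 else 0) * f b) = 0"
        by (auto simp: monom_splits_def split: if_splits)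
      show "{(0, m)} \<subseteq> monom_splits m" by (simp add: monom_splits_def)
    qed simp
    then show "(\<Sum>(a, b)\<in>monom_splits m. (if a = 0 then 1 else 0) * f b) = f m" by simp
  qed
  show "(f + g) * h = f * h + g * h"
    by transfer (auto simp: distrib_right sum.distrib split_def)
  show "(0 :: 'a power_series) \<noteq> 1"
    by transfer (metis zero_neq_one)
qed (transfer; simp add: algebra_simps)+

end

definition monom_of :: "'v list \<Rightarrow> nat list \<Rightarrow> 'v monomial"
  where "monom_of vs \<alpha> = (\<Sum>(v, k)\<leftarrow>zip vs \<alpha>. Poly_Mapping.single v k)"

text \<open>The lists \<open>vs\<close>, \<open>ws\<close> are the increasing sequences of variables carrying the exponents of the
  composition \<open>\<alpha>\<close>.\<close>

definition quasisymmetric :: "'v::linorder power_series \<Rightarrow> bool"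
  where "quasisymmetric g \<longleftrightarrow>
    (\<exists>d. \<forall>m. coeff g m \<noteq> 0 \<longrightarrow> mdegree m \<le> d) \<and>
    (\<forall>\<alpha> vs ws. (\<forall>k\<in>set \<alpha>. 0 < k) \<longrightarrow>
      length vs = length \<alpha> \<longrightarrow> sorted_wrt (<) vs \<longrightarrow>
      length ws = length \<alpha> \<longrightarrow> sorted_wrt (<) ws \<longrightarrow>
      coeff g (monom_of vs \<alpha>) = coeff g (monom_of ws \<alpha>))"

lemma monom_of_simps [simp]:
  "monom_of [] \<alpha> = 0" "monom_of vs [] = 0"
  "monom_of (v # vs) (k # \<alpha>) = Poly_Mapping.single v k + monom_of vs \<alpha>"
  by (simp_all add: monom_of_def)

lemma sorted_wrt_less_distinct: "sorted_wrt (<) vs \<Longrightarrow> distinct (vs :: 'v::linorder list)"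
  by (simp add: strict_sorted_iff)

lemma keys_monom_of: "Poly_Mapping.keys (monom_of vs \<alpha>) \<subseteq> set vs"
proof (induction vs \<alpha> rule: list_induct2')
  case (4 v vs k \<alpha>)
  have "Poly_Mapping.keys (Poly_Mapping.single v k + monom_of vs \<alpha>)
      \<subseteq> Poly_Mapping.keys (Poly_Mapping.single v k) \<union> Poly_Mapping.keys (monom_of vs \<alpha>)"
    by (rule Poly_Mapping.keys_add)
  with 4 show ?case by (auto split: if_splits)
qed auto

lemma lookup_monom_of_notin: "v \<notin> set vs \<Longrightarrow> Poly_Mapping.lookup (monom_of vs \<alpha>) v = 0"
  using keys_monom_of [of vs \<alpha>] by (auto simp: in_keys_iff)

lemma map_lookup_monom_of:
  "length vs = length \<alpha> \<Longrightarrow> distinct vs \<Longrightarrow> map (Poly_Mapping.lookup (monom_of vs \<alpha>)) vs = \<alpha>"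
proof (induction vs \<alpha> rule: list_induct2)
  case (Cons v vs k \<alpha>)
  have "map (Poly_Mapping.lookup (monom_of (v # vs) (k # \<alpha>))) vs
      = map (Poly_Mapping.lookup (monom_of vs \<alpha>)) vs"
    using Cons.prems by (intro map_cong) (auto simp: lookup_add lookup_single when_def)
  moreover have "Poly_Mapping.lookup (monom_of (v # vs) (k # \<alpha>)) v = k"
    using Cons.prems by (simp add: lookup_add lookup_monom_of_notin)
  ultimately show ?case
    using Cons by (metis distinct.simps(2) list.simps(9))
qed simp

lemma lookup_monom_of_map:
  "distinct vs \<Longrightarrow> Poly_Mapping.lookup (monom_of vs (map f vs)) v = (if v \<in> set vs then f v else 0)"
  by (induction vs) (auto simp: lookup_add lookup_single when_def lookup_monom_of_notin)

lemma monom_of_map_lookup: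
  assumes "distinct vs" "Poly_Mapping.keys a \<subseteq> set vs"
  shows "monom_of vs (map (Poly_Mapping.lookup a) vs) = a"
  using assms by (intro poly_mapping_eqI) (auto simp: lookup_monom_of_map in_keys_iff)

lemma monom_of_add:
  "length vs = length \<beta> \<Longrightarrow> length vs = length \<gamma> \<Longrightarrow>
    monom_of vs \<beta> + monom_of vs \<gamma> = monom_of vs (map2 (+) \<beta> \<gamma>)"
proof (induction vs arbitrary: \<beta> \<gamma>)
  case (Cons v vs)
  then obtain b \<beta>' c \<gamma>' where "\<beta> = b # \<beta>'" "\<gamma> = c # \<gamma>'"
    by (metis length_Suc_conv)
  moreover from this Cons have *:
    "monom_of vs \<beta>' + monom_of vs \<gamma>' = monom_of vs (map2 (+) \<beta>' \<gamma>')" by simp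
  ultimately show ?case by (simp add: single_add add_ac flip: *)
qed simp

lemma monom_of_filter:
  "length vs = length \<alpha> \<Longrightarrow>
    monom_of (map fst (filter (\<lambda>(v, k). 0 < k) (zip vs \<alpha>))) (filter ((<) 0) \<alpha>) = monom_of vs \<alpha>"
  by (induction vs \<alpha> rule: list_induct2) auto

lemma quasisymmetric_weak:
  fixes g :: "'v::linorder power_series"
  assumes g: "quasisymmetric g"
    and vs: "length vs = length \<alpha>" "sorted_wrt (<) vs"
    and ws: "length ws = length \<alpha>" "sorted_wrt (<) ws"
  shows "coeff g (monom_of vs \<alpha>) = coeff g (monom_of ws \<alpha>)"
proof -
  let ?f = "\<lambda>vs :: 'v list. map fst (filter (\<lambda>(v, k). 0 < k) (zip vs \<alpha>))"
  let ?\<alpha> = "filter ((<) 0) \<alpha>"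
  have *: "length (?f us) = length ?\<alpha> \<and> sorted_wrt (<) (?f us) \<and> set (?f us) \<subseteq> set us"
    if "length us = length \<alpha>" "sorted_wrt (<) us" for us :: "'v list"
    using that by (induction us \<alpha> rule: list_induct2) auto
  have "\<forall>k\<in>set ?\<alpha>. 0 < k" by simp
  then have "coeff g (monom_of (?f vs) ?\<alpha>) = coeff g (monom_of (?f ws) ?\<alpha>)"
    using g * [OF vs] * [OF ws] unfolding quasisymmetric_def by blast
  then show ?thesis using vs ws by (simp add: monom_of_filter)
qed

lemma coeff_mult_monom_of:
  assumes "distinct vs" "length vs = length \<alpha>"
  shows "coeff (f * g) (monom_of vs \<alpha>) =
    (\<Sum>(\<beta>, \<gamma>)\<in>{(\<beta>, \<gamma>). length \<beta> = length \<alpha> \<and> length \<gamma> = length \<alpha> \<and> map2 (+) \<beta> \<gamma> = \<alpha>}.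
      coeff f (monom_of vs \<beta>) * coeff g (monom_of vs \<gamma>))"
  unfolding times_power_series.rep_eq
proof (rule sum.reindex_bij_witness [where
        j = "\<lambda>(a, b). (map (Poly_Mapping.lookup a) vs, map (Poly_Mapping.lookup b) vs)" and
        i = "\<lambda>(\<beta>, \<gamma>). (monom_of vs \<beta>, monom_of vs \<gamma>)"])
  fix ab assume "ab \<in> monom_splits (monom_of vs \<alpha>)"
  then obtain a b where ab: "ab = (a, b)" "a + b = monom_of vs \<alpha>"
    by (auto simp: monom_splits_def)
  have "Poly_Mapping.keys a \<subseteq> set vs" "Poly_Mapping.keys b \<subseteq> set vs"
    using keys_monom_of [of vs \<alpha>] unfolding ab(2) [symmetric]
    by (auto simp: in_keys_iff lookup_add)
  then have a: "monom_of vs (map (Poly_Mapping.lookup a) vs) = a"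
    and b: "monom_of vs (map (Poly_Mapping.lookup b) vs) = b"
    using assms(1) by (simp_all add: monom_of_map_lookup)
  show "(\<lambda>(\<beta>, \<gamma>). (monom_of vs \<beta>, monom_of vs \<gamma>))
      ((\<lambda>(a, b). (map (Poly_Mapping.lookup a) vs, map (Poly_Mapping.lookup b) vs)) ab) = ab"
    using ab a b by simp
  have "map2 (+) (map (Poly_Mapping.lookup a) vs) (map (Poly_Mapping.lookup b) vs)
      = map (Poly_Mapping.lookup (a + b)) vs"
    by (induction vs) (simp_all add: lookup_add)
  also have "\<dots> = \<alpha>"
    using assms ab(2) by (simp add: map_lookup_monom_of)
  finally show "(\<lambda>(a, b). (map (Poly_Mapping.lookup a) vs, map (Poly_Mapping.lookup b) vs)) ab
      \<in> {(\<beta>, \<gamma>). length \<beta> = length \<alpha> \<and> length \<gamma> = length \<alpha> \<and> map2 (+) \<beta> \<gamma> = \<alpha>}"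
    using ab assms by simp
  show "(case (case ab of (a, b) \<Rightarrow> (map (Poly_Mapping.lookup a) vs, map (Poly_Mapping.lookup b) vs)) of
      (\<beta>, \<gamma>) \<Rightarrow> coeff f (monom_of vs \<beta>) * coeff g (monom_of vs \<gamma>)) =
      (case ab of (a, b) \<Rightarrow> coeff f a * coeff g b)"
    using ab a b by simp
next
  fix \<beta>\<gamma> :: "nat list \<times> nat list"
  assume "\<beta>\<gamma> \<in> {(\<beta>, \<gamma>). length \<beta> = length \<alpha> \<and> length \<gamma> = length \<alpha> \<and> map2 (+) \<beta> \<gamma> = \<alpha>}"
  then obtain \<beta> \<gamma> where bg: "\<beta>\<gamma> = (\<beta>, \<gamma>)" "length \<beta> = length \<alpha>" "length \<gamma> = length \<alpha>"
    "map2 (+) \<beta> \<gamma> = \<alpha>" by auto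
  show "(case case \<beta>\<gamma> of (\<beta>, \<gamma>) \<Rightarrow> (monom_of vs \<beta>, monom_of vs \<gamma>) of
      (a, b) \<Rightarrow> (map (Poly_Mapping.lookup a) vs, map (Poly_Mapping.lookup b) vs)) = \<beta>\<gamma>"
    using bg assms by (simp add: map_lookup_monom_of)
  show "(case \<beta>\<gamma> of (\<beta>, \<gamma>) \<Rightarrow> (monom_of vs \<beta>, monom_of vs \<gamma>)) \<in> monom_splits (monom_of vs \<alpha>)"
    using bg assms by (simp add: monom_splits_def monom_of_add)
qed

lemma quasisymmetric_0: "quasisymmetric 0"
  by (simp add: quasisymmetric_def zero_power_series.rep_eq)

lemma quasisymmetric_1: "quasisymmetric 1"
proof -
  have *: "monom_of vs \<alpha> = 0 \<longleftrightarrow> (\<forall>k\<in>set \<alpha>. k = 0)" if "length vs = length \<alpha>"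
    for vs :: "'a list" and \<alpha>
    using that
  proof (induction vs \<alpha> rule: list_induct2)
    case (Cons v vs k \<alpha>)
    have "Poly_Mapping.single v k + monom_of vs \<alpha> = 0 \<longleftrightarrow>
        Poly_Mapping.single v k = 0 \<and> monom_of vs \<alpha> = 0"
      by (auto simp: poly_mapping_eq_iff fun_eq_iff lookup_add)
    moreover have "Poly_Mapping.single v k = 0 \<longleftrightarrow> k = 0"
      by (metis lookup_single_eq lookup_zero single_zero)
    ultimately show ?case using Cons by simp
  qed simp
  have "\<exists>d. \<forall>m :: 'a monomial. (if m = 0 then 1 else 0 :: int) \<noteq> 0 \<longrightarrow> mdegree m \<le> d"
    by (rule exI [of _ 0]) simp
  then show ?thesis
    unfolding quasisymmetric_def one_power_series.rep_eq by (simp add: *)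
qed

lemma quasisymmetric_uminus: "quasisymmetric f \<Longrightarrow> quasisymmetric (- f)"
  unfolding quasisymmetric_def uminus_power_series.rep_eq neg_equal_0_iff_equal neg_equal_iff_equal .

lemma quasisymmetric_add:
  assumes "quasisymmetric f" "quasisymmetric g"
  shows "quasisymmetric (f + g)"
proof -
  from assms obtain c d where
    "\<And>m. coeff f m \<noteq> 0 \<Longrightarrow> mdegree m \<le> c" "\<And>m. coeff g m \<noteq> 0 \<Longrightarrow> mdegree m \<le> d"
    unfolding quasisymmetric_def by blast
  then have "\<forall>m. coeff f m + coeff g m \<noteq> 0 \<longrightarrow> mdegree m \<le> max c d"
    by (metis add.right_neutral le_max_iff_disj)
  then show ?thesis
    using assms unfolding quasisymmetric_def plus_power_series.rep_eq by metis
qed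

lemma quasisymmetric_mult:
  assumes f: "quasisymmetric f" and g: "quasisymmetric g"
  shows "quasisymmetric (f * g)"
proof -
  from assms obtain c d where cd:
    "\<And>m. coeff f m \<noteq> 0 \<Longrightarrow> mdegree m \<le> c" "\<And>m. coeff g m \<noteq> 0 \<Longrightarrow> mdegree m \<le> d"
    unfolding quasisymmetric_def by blast
  have "mdegree m \<le> c + d" if nz: "coeff (f * g) m \<noteq> 0" for m
  proof -
    from nz obtain a b where "a + b = m" "coeff f a * coeff g b \<noteq> 0"
      unfolding times_power_series.rep_eq monom_splits_def
      by (elim sum.not_neutral_contains_not_neutral) auto
    with cd show ?thesis by (metis add_mono mdegree_add mult_eq_0_iff)
  qed
  moreover have "coeff (f * g) (monom_of vs \<alpha>) = coeff (f * g) (monom_of ws \<alpha>)"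
    if vs: "length vs = length \<alpha>" "sorted_wrt (<) vs"
      and ws: "length ws = length \<alpha>" "sorted_wrt (<) ws" for vs ws :: "'a list" and \<alpha>
  proof -
    have "coeff f (monom_of vs \<beta>) = coeff f (monom_of ws \<beta>)"
         "coeff g (monom_of vs \<beta>) = coeff g (monom_of ws \<beta>)"
      if "length \<beta> = length \<alpha>" for \<beta>
      using quasisymmetric_weak [OF f] quasisymmetric_weak [OF g] vs ws that by metis+
    note eq = this
    show ?thesis
      unfolding coeff_mult_monom_of [OF sorted_wrt_less_distinct [OF vs(2)] vs(1)]
        coeff_mult_monom_of [OF sorted_wrt_less_distinct [OF ws(2)] ws(1)]
    by (rule sum.cong [OF refl]) (auto simp: eq simp del: length_map split: prod.splits)
  qed
  ultimately show ?thesis unfolding quasisymmetric_def by blast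
qed

text \<open>The variables \<open>x\<^sub>1, x\<^sub>2, \<dots>\<close> are indexed by \<open>num\<close>, the library's type of positive integers.\<close>

typedef qsym = "{g :: num power_series. quasisymmetric g}"
  morphisms series_of_qsym Abs_qsym
  using quasisymmetric_0 by blast

setup_lifting type_definition_qsym

instantiation qsym :: comm_ring_1
begin

lift_definition zero_qsym :: qsym is 0 by (rule quasisymmetric_0)
lift_definition one_qsym :: qsym is 1 by (rule quasisymmetric_1)
lift_definition plus_qsym :: "qsym \<Rightarrow> qsym \<Rightarrow> qsym" is "(+)" by (rule quasisymmetric_add)
lift_definition uminus_qsym :: "qsym \<Rightarrow> qsym" is uminus by (rule quasisymmetric_uminus)
lift_definition minus_qsym :: "qsym \<Rightarrow> qsym \<Rightarrow> qsym" is "(-)"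
  by (metis quasisymmetric_add quasisymmetric_uminus diff_conv_add_uminus)
lift_definition times_qsym :: "qsym \<Rightarrow> qsym \<Rightarrow> qsym" is "(*)" by (rule quasisymmetric_mult)

instance
  by standard (transfer; simp add: algebra_simps)+

end

datatype xy_var = xvar num | yvar num

instantiation xy_var :: linorder
begin

fun less_eq_xy_var :: "xy_var \<Rightarrow> xy_var \<Rightarrow> bool" where
  "xvar i \<le> xvar j \<longleftrightarrow> i \<le> j"
| "xvar i \<le> yvar j \<longleftrightarrow> True"
| "yvar i \<le> xvar j \<longleftrightarrow> False"
| "yvar i \<le> yvar j \<longleftrightarrow> i \<le> j"

definition less_xy_var :: "xy_var \<Rightarrow> xy_var \<Rightarrow> bool"
  where "v < w \<longleftrightarrow> v \<le> w \<and> \<not> w \<le> (v :: xy_var)"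

instance
proof
  fix u v w :: xy_var
  show "v < w \<longleftrightarrow> v \<le> w \<and> \<not> w \<le> v" by (rule less_xy_var_def)
  show "v \<le> v" by (cases v) auto
  show "u \<le> v \<Longrightarrow> v \<le> w \<Longrightarrow> u \<le> w" by (cases u; cases v; cases w) auto
  show "v \<le> w \<Longrightarrow> w \<le> v \<Longrightarrow> v = w" by (cases v; cases w) auto
  show "v \<le> w \<or> w \<le> v" by (cases v; cases w) auto
qed

end

definition rename_monom :: "('v \<Rightarrow> 'w) \<Rightarrow> 'v monomial \<Rightarrow> 'w monomial"
  where "rename_monom r m =
    (\<Sum>v\<in>Poly_Mapping.keys m. Poly_Mapping.single (r v) (Poly_Mapping.lookup m v))"

text \<open>For injective \<open>r\<close>, the only case used, the sum has at most one term.\<close>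

lift_definition rename_series :: "('v \<Rightarrow> 'w) \<Rightarrow> 'v power_series \<Rightarrow> 'w power_series"
  is "\<lambda>r g m. \<Sum>n | rename_monom r n = m. g n" .

lift_definition set_y_zero :: "xy_var power_series \<Rightarrow> num power_series"
  is "\<lambda>h m. h (rename_monom xvar m)" .

text \<open>That the descriptions in the next two definitions determine unique objects is proved below as
  \<open>ex1_xy_extension\<close> and \<open>ex1_qsym_comult\<close>.\<close>

definition xy_extension :: "qsym \<Rightarrow> xy_var power_series"
  where "xy_extension g = (THE h. quasisymmetric h \<and> set_y_zero h = series_of_qsym g)"

abbreviation xy_product :: "qsym \<Rightarrow> qsym \<Rightarrow> xy_var power_series"
  where "xy_product a b \<equiv> rename_series xvar (series_of_qsym a) * rename_series yvar (series_of_qsym b)"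

definition qsym_comult :: "qsym \<Rightarrow> (qsym, qsym) tensor"
  where "qsym_comult g = (THE t. \<exists>ghs.
    xy_extension g = (\<Sum>(a, b)\<leftarrow>ghs. xy_product a b) \<and> t = (\<Sum>(a, b)\<leftarrow>ghs. a \<otimes> b))"

definition qsym_counit :: "qsym \<Rightarrow> int"
  where "qsym_counit g = coeff (series_of_qsym g) 0"

lemma rename_monom_superset:
  assumes "finite S" "Poly_Mapping.keys m \<subseteq> S"
  shows "rename_monom r m = (\<Sum>v\<in>S. Poly_Mapping.single (r v) (Poly_Mapping.lookup m v))"
  unfolding rename_monom_def using assms
  by (intro sum.mono_neutral_left) (auto simp: in_keys_iff)

lemma rename_monom_add: "rename_monom r (m + n) = rename_monom r m + rename_monom r n"
proof -
  let ?S = "Poly_Mapping.keys m \<union> Poly_Mapping.keys n"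
  show ?thesis using Poly_Mapping.keys_add [of m n]
    by (simp add: rename_monom_superset [of ?S] lookup_add single_add sum.distrib)
qed

lemma rename_monom_monom_of:
  "length vs = length \<alpha> \<Longrightarrow> rename_monom r (monom_of vs \<alpha>) = monom_of (map r vs) \<alpha>"
proof (induction vs \<alpha> rule: list_induct2)
  case Nil
  show ?case by (simp add: rename_monom_def)
next
  case (Cons v vs k \<alpha>)
  have "rename_monom r (Poly_Mapping.single v k) = Poly_Mapping.single (r v) k"
    by (simp add: rename_monom_def)
  with Cons show ?case by (simp add: rename_monom_add)
qed

lemma lookup_rename_monom:
  "inj r \<Longrightarrow> Poly_Mapping.lookup (rename_monom r m) (r v) = Poly_Mapping.lookup m v"
  by (simp add: rename_monom_def lookup_sum lookup_single when_def inj_eq in_keys_iff)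

lemma lookup_rename_monom_notin:
  "w \<notin> range r \<Longrightarrow> Poly_Mapping.lookup (rename_monom r m) w = 0"
  by (auto simp: rename_monom_def lookup_sum lookup_single when_def intro!: sum.neutral)

lemma inj_rename_monom: "inj r \<Longrightarrow> inj (rename_monom r)"
  by (rule injI, rule poly_mapping_eqI) (metis lookup_rename_monom)

lemma coeff_rename_series:
  assumes "inj r"
  shows "coeff (rename_series r g) (rename_monom r m) = coeff g m"
proof -
  have "{n. rename_monom r n = rename_monom r m} = {m}"
    using inj_rename_monom [OF assms] by (auto dest: injD)
  then show ?thesis by (simp add: rename_series.rep_eq)
qed

lemma coeff_rename_series_notin:
  "m \<notin> range (rename_monom r) \<Longrightarrow> coeff (rename_series r g) m = 0"
  unfolding rename_series.rep_eq by (rule sum.neutral) auto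

lemma inj_xvar [simp]: "inj xvar" and inj_yvar [simp]: "inj yvar"
  by (auto intro: injI)

abbreviation xy_monom :: "num monomial \<Rightarrow> num monomial \<Rightarrow> xy_var monomial"
  where "xy_monom m n \<equiv> rename_monom xvar m + rename_monom yvar n"

lemma lookup_xy_monom [simp]:
  "Poly_Mapping.lookup (xy_monom m n) (xvar i) = Poly_Mapping.lookup m i"
  "Poly_Mapping.lookup (xy_monom m n) (yvar i) = Poly_Mapping.lookup n i"
  by (simp_all add: lookup_add lookup_rename_monom lookup_rename_monom_notin image_iff)

lemma ex_xy_monom: "\<exists>m n. u = xy_monom m n"
proof (intro exI poly_mapping_eqI)
  fix v
  show "Poly_Mapping.lookup u v =
    Poly_Mapping.lookup (xy_monom (Poly_Mapping.map_key xvar u) (Poly_Mapping.map_key yvar u)) v"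
    by (cases v) (simp_all add: map_key.rep_eq)
qed

lemma xy_monom_eq_iff [simp]: "xy_monom m n = xy_monom m' n' \<longleftrightarrow> m = m' \<and> n = n'"
  by (metis lookup_xy_monom poly_mapping_eqI)

lemma coeff_xy_mult:
  "coeff (rename_series xvar a * rename_series yvar b) (xy_monom m n) = coeff a m * coeff b n"
proof -
  let ?p = "\<lambda>(u, v). coeff (rename_series xvar a) u * coeff (rename_series yvar b) v"
  have "sum ?p (monom_splits (xy_monom m n)) = sum ?p {(rename_monom xvar m, rename_monom yvar n)}"
  proof (rule sum.mono_neutral_right)
    show "\<forall>s\<in>monom_splits (xy_monom m n) - {(rename_monom xvar m, rename_monom yvar n)}. ?p s = 0"
    proof
      fix s assume s: "s \<in> monom_splits (xy_monom m n) - {(rename_monom xvar m, rename_monom yvar n)}"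
      obtain u v where uv: "s = (u, v)" by (cases s)
      with s have sum: "u + v = xy_monom m n" by (simp add: monom_splits_def)
      show "?p s = 0"
      proof (rule ccontr)
        assume nz: "?p s \<noteq> 0"
        from nz uv obtain m' where m': "u = rename_monom xvar m'"
          using coeff_rename_series_notin [of u xvar a] by auto
        from nz uv obtain n' where n': "v = rename_monom yvar n'"
          using coeff_rename_series_notin [of v yvar b] by auto
        from sum m' n' have "m' = m \<and> n' = n" by simp
        with s uv m' n' show False by simp
      qed
    qed
    show "{(rename_monom xvar m, rename_monom yvar n)} \<subseteq> monom_splits (xy_monom m n)"
      by (simp add: monom_splits_def)
  qed simp
  then show ?thesis by (simp add: times_power_series.rep_eq coeff_rename_series)
qed

definition exponents :: "'v::linorder monomial \<Rightarrow> nat list"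
  where "exponents m = map (Poly_Mapping.lookup m) (sorted_list_of_set (Poly_Mapping.keys m))"

lemma exponents_pos: "\<forall>k\<in>set (exponents m). 0 < k"
  by (simp add: exponents_def in_keys_iff)

lemma monom_of_exponents:
  "monom_of (sorted_list_of_set (Poly_Mapping.keys m)) (exponents m) = m"
  by (simp add: exponents_def monom_of_map_lookup)

lemma exponents_monom_of:
  assumes "\<forall>k\<in>set \<alpha>. 0 < k" "length vs = length \<alpha>" "sorted_wrt (<) vs"
  shows "exponents (monom_of vs \<alpha>) = \<alpha>"
proof -
  have d: "distinct vs" using assms(3) by (rule sorted_wrt_less_distinct)
  have "Poly_Mapping.lookup (monom_of vs \<alpha>) v > 0" if "v \<in> set vs" for v
  proof -
    from that obtain i where "i < length vs" "v = vs ! i" by (metis in_set_conv_nth)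
    moreover from this have "Poly_Mapping.lookup (monom_of vs \<alpha>) v
        = map (Poly_Mapping.lookup (monom_of vs \<alpha>)) vs ! i" by simp
    ultimately show ?thesis
      using assms map_lookup_monom_of [OF assms(2) d] by simp
  qed
  then have "Poly_Mapping.keys (monom_of vs \<alpha>) = set vs"
    using keys_monom_of by (fastforce simp: in_keys_iff)
  moreover have "sorted_list_of_set (set vs) = vs"
    using assms(3) by (metis d sorted_distinct_set_unique sorted_list_of_set.distinct_sorted_key_list_of_set
        set_sorted_list_of_set List.finite_set sorted_list_of_set.sorted_sorted_key_list_of_set strict_sorted_iff)
  ultimately show ?thesis
    unfolding exponents_def using map_lookup_monom_of [OF assms(2) d] by simp
qed

lemma mdegree_monom_of: "length vs = length \<alpha> \<Longrightarrow> mdegree (monom_of vs \<alpha>) = sum_list \<alpha>"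
  by (induction vs \<alpha> rule: list_induct2) (simp_all add: mdegree_add)

lemma sum_list_exponents: "sum_list (exponents m) = mdegree m"
  using mdegree_monom_of [of "sorted_list_of_set (Poly_Mapping.keys m)" "exponents m"]
  by (simp add: monom_of_exponents) (simp add: exponents_def)

lemma coeff_exponents_cong:
  assumes "quasisymmetric g" "exponents m = exponents n"
  shows "coeff g m = coeff g n"
proof -
  let ?l = "\<lambda>m. sorted_list_of_set (Poly_Mapping.keys m)"
  have "coeff g (monom_of (?l m) (exponents m)) = coeff g (monom_of (?l n) (exponents m))"
  proof (rule quasisymmetric_weak [OF assms(1)])
    show "length (?l n) = length (exponents m)"
      unfolding assms(2) by (simp add: exponents_def)
  qed (simp_all add: exponents_def strict_sorted_iff)
  then show ?thesis using assms(2) by (metis monom_of_exponents)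
qed

lemma quasisymmetricI:
  assumes "\<And>m. coeff g m \<noteq> 0 \<Longrightarrow> mdegree m \<le> d"
    and "\<And>m n. exponents m = exponents n \<Longrightarrow> coeff g m = coeff g n"
  shows "quasisymmetric g"
  unfolding quasisymmetric_def
proof (intro conjI allI impI exI)
  show "coeff g m \<noteq> 0 \<Longrightarrow> mdegree m \<le> d" for m by (rule assms(1))
qed (rule assms(2), simp add: exponents_monom_of)

definition std_monom :: "nat list \<Rightarrow> num monomial"
  where "std_monom \<alpha> = monom_of (map num_of_nat [1..<Suc (length \<alpha>)]) \<alpha>"

lemma sorted_nums: "sorted_wrt (<) (map num_of_nat [1..<Suc k])"
proof -
  have "sorted_wrt (\<lambda>i j. num_of_nat i < num_of_nat j) [1..<Suc k]"
    using sorted_wrt_upt [of 1 "Suc k"]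
    by (rule sorted_wrt_mono_rel [rotated]) (auto simp: less_num_def num_of_nat_inverse)
  then show ?thesis by (simp add: sorted_wrt_map del: upt_Suc)
qed

lemma exponents_std_monom: "\<forall>k\<in>set \<alpha>. 0 < k \<Longrightarrow> exponents (std_monom \<alpha>) = \<alpha>"
  unfolding std_monom_def by (rule exponents_monom_of) (use sorted_nums in \<open>simp_all del: upt_Suc\<close>)

lemma rename_monom_exponents:
  "rename_monom r m = monom_of (map r (sorted_list_of_set (Poly_Mapping.keys m))) (exponents m)"
  using rename_monom_monom_of [of "sorted_list_of_set (Poly_Mapping.keys m)" "exponents m" r]
  by (simp add: monom_of_exponents) (simp add: exponents_def)

lemma xy_less [simp]:
  "xvar i < xvar j \<longleftrightarrow> i < j" "yvar i < yvar j \<longleftrightarrow> i < j" "xvar i < yvar j"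
  by (auto simp: less_xy_var_def)

lemma monom_of_append:
  "length vs = length \<alpha> \<Longrightarrow> monom_of (vs @ ws) (\<alpha> @ \<beta>) = monom_of vs \<alpha> + monom_of ws \<beta>"
  by (simp add: monom_of_def)

lemma exponents_xy_monom: "exponents (xy_monom m n) = exponents m @ exponents n"
proof -
  let ?l = "\<lambda>m. sorted_list_of_set (Poly_Mapping.keys m)"
  have len: "length (?l m) = length (exponents m)" for m :: "num monomial"
    by (simp add: exponents_def)
  have "xy_monom m n = monom_of (map xvar (?l m) @ map yvar (?l n)) (exponents m @ exponents n)"
    unfolding rename_monom_exponents
    by (rule monom_of_append [symmetric]) (simp add: exponents_def)
  also have "exponents \<dots> = exponents m @ exponents n"
  proof (rule exponents_monom_of)
    have s: "sorted_wrt (<) (?l m)" for m :: "num monomial"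
      by (simp add: strict_sorted_iff)
    show "sorted_wrt (<) (map xvar (?l m) @ map yvar (?l n))"
      using s [of m] s [of n] by (auto simp: sorted_wrt_append sorted_wrt_map)
  qed (use exponents_pos [of m] exponents_pos [of n] in \<open>auto simp flip: len\<close>)
  finally show ?thesis .
qed

lemma rename_monom_0 [simp]: "rename_monom r 0 = 0"
  by (simp add: rename_monom_def)

lemma exponents_0 [simp]: "exponents 0 = []"
  by (simp add: exponents_def)

lemma exponents_rename_xvar [simp]: "exponents (rename_monom xvar m) = exponents m"
  using exponents_xy_monom [of m 0] by simp

lemma quasisymmetric_degree:
  "quasisymmetric g \<Longrightarrow> \<exists>d. \<forall>m. coeff g m \<noteq> 0 \<longrightarrow> mdegree m \<le> d"
  by (simp add: quasisymmetric_def)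

lemma quasisymmetric_series_of_qsym: "quasisymmetric (series_of_qsym g)"
  using series_of_qsym by blast

lemma ex1_xy_extension: "\<exists>!h. quasisymmetric h \<and> set_y_zero h = series_of_qsym g"
proof (rule ex_ex1I)
  note g = quasisymmetric_series_of_qsym [of g]
  define h :: "xy_var power_series" where
    "h = Abs_power_series (\<lambda>m. coeff (series_of_qsym g) (std_monom (exponents m)))"
  have h: "coeff h m = coeff (series_of_qsym g) (std_monom (exponents m))" for m
    by (simp add: h_def Abs_power_series_inverse)
  obtain d where d: "\<And>m. coeff (series_of_qsym g) m \<noteq> 0 \<Longrightarrow> mdegree m \<le> d"
    using quasisymmetric_degree [OF g] by blast
  have "quasisymmetric h"
  proof (rule quasisymmetricI)
    show "mdegree m \<le> d" if "coeff h m \<noteq> 0" for m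
      using d [of "std_monom (exponents m)"] that exponents_std_monom [OF exponents_pos [of m]]
      by (metis h sum_list_exponents)
    show "coeff h m = coeff h n" if "exponents m = exponents n" for m n
      using that by (simp add: h)
  qed
  moreover have "set_y_zero h = series_of_qsym g"
    by (rule power_series_eqI, unfold set_y_zero.rep_eq h, rule coeff_exponents_cong [OF g])
      (simp add: exponents_std_monom exponents_pos)
  ultimately show "\<exists>h. quasisymmetric h \<and> set_y_zero h = series_of_qsym g" by blast
next
  fix h h' assume
    h: "quasisymmetric h \<and> set_y_zero h = series_of_qsym g" and
    h': "quasisymmetric h' \<and> set_y_zero h' = series_of_qsym g"
  show "h = h'"
  proof (rule power_series_eqI)
    fix m :: "xy_var monomial"
    let ?m = "std_monom (exponents m)"
    have *: "exponents m = exponents (rename_monom xvar ?m)"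
      by (simp add: exponents_std_monom exponents_pos)
    have "coeff h m = coeff (set_y_zero h) ?m"
      unfolding set_y_zero.rep_eq by (rule coeff_exponents_cong) (use h * in auto)
    also have "\<dots> = coeff (set_y_zero h') ?m" using h h' by simp
    also have "\<dots> = coeff h' m"
      unfolding set_y_zero.rep_eq by (rule coeff_exponents_cong) (use h' * in auto)
    finally show "coeff h m = coeff h' m" .
  qed
qed

lemma xy_extension:
  "quasisymmetric (xy_extension g)" "set_y_zero (xy_extension g) = series_of_qsym g"
  using theI' [OF ex1_xy_extension [of g]] unfolding xy_extension_def by auto

definition compositions :: "nat \<Rightarrow> nat list set"
  where "compositions d = {\<alpha>. (\<forall>k\<in>set \<alpha>. 0 < k) \<and> sum_list \<alpha> \<le> d}"

lemma finite_compositions [simp]: "finite (compositions d)"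
proof (rule finite_subset)
  have "length \<alpha> \<le> sum_list \<alpha>" if "\<forall>k\<in>set \<alpha>. 0 < k" for \<alpha> :: "nat list"
    using that by (induction \<alpha>) auto
  then show "compositions d \<subseteq> {\<alpha>. set \<alpha> \<subseteq> {..d} \<and> length \<alpha> \<le> d}"
    unfolding compositions_def using member_le_sum_list by (fastforce dest: order_trans)
qed (rule finite_lists_length_le, simp)

lift_definition monomial_qsym :: "nat list \<Rightarrow> qsym"
  is "\<lambda>\<alpha>. Abs_power_series (\<lambda>m. if exponents m = \<alpha> then 1 else 0)"
proof (rule quasisymmetricI)
  fix \<alpha> and m :: "num monomial"
  show "coeff (Abs_power_series (\<lambda>m. if exponents m = \<alpha> then 1 else 0)) m \<noteq> 0 \<Longrightarrow>
      mdegree m \<le> sum_list \<alpha>"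
    by (auto simp: Abs_power_series_inverse simp flip: sum_list_exponents split: if_splits)
qed (simp add: Abs_power_series_inverse)

lemma coeff_monomial_qsym:
  "coeff (series_of_qsym (monomial_qsym \<alpha>)) m = (if exponents m = \<alpha> then 1 else 0)"
  by (simp add: monomial_qsym.rep_eq Abs_power_series_inverse)

lemma additive_int_scale: "additive f \<Longrightarrow> f (int_scale k a) = int_scale k (f a)"
  for f :: "'a::ab_group_add \<Rightarrow> 'b::ab_group_add"
  unfolding int_scale_def by (simp add: additive.diff additive.sum)

lemma int_scale_int [simp]: "int_scale k (a :: int) = k * a"
  by (simp add: int_scale_def algebra_simps)

lemma additive_coeff_qsym: "additive (\<lambda>g. coeff (series_of_qsym g) m)"
  by standard (simp add: plus_qsym.rep_eq plus_power_series.rep_eq)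

lemma qsym_eqI: "(\<And>m. coeff (series_of_qsym f) m = coeff (series_of_qsym g) m) \<Longrightarrow> f = g"
  by (metis power_series_eqI series_of_qsym_inject)

lemma qsym_expansion:
  assumes "\<And>m. coeff (series_of_qsym g) m \<noteq> 0 \<Longrightarrow> mdegree m \<le> d"
  shows "g = (\<Sum>\<alpha>\<in>compositions d. int_scale (coeff (series_of_qsym g) (std_monom \<alpha>)) (monomial_qsym \<alpha>))"
proof (rule qsym_eqI)
  fix m
  let ?c = "\<lambda>\<alpha>. coeff (series_of_qsym g) (std_monom \<alpha>)"
  have "coeff (series_of_qsym (\<Sum>\<alpha>\<in>compositions d. int_scale (?c \<alpha>) (monomial_qsym \<alpha>))) m
      = (\<Sum>\<alpha>\<in>compositions d. ?c \<alpha> * coeff (series_of_qsym (monomial_qsym \<alpha>)) m)"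
    by (simp add: additive.sum [OF additive_coeff_qsym] additive_int_scale [OF additive_coeff_qsym])
  also have "\<dots> = (if exponents m \<in> compositions d then ?c (exponents m) else 0)"
    by (simp add: coeff_monomial_qsym if_distrib cong: if_cong)
  also have "\<dots> = coeff (series_of_qsym g) m"
  proof -
    have "exponents m \<in> compositions d \<longleftrightarrow> mdegree m \<le> d"
      by (simp add: compositions_def exponents_pos sum_list_exponents)
    moreover have "?c (exponents m) = coeff (series_of_qsym g) m"
      by (rule coeff_exponents_cong) (simp_all add: quasisymmetric_series_of_qsym
          exponents_std_monom exponents_pos)
    ultimately show ?thesis using assms [of m] by auto
  qed
  finally show "coeff (series_of_qsym g) m
    = coeff (series_of_qsym (\<Sum>\<alpha>\<in>compositions d. int_scale (?c \<alpha>) (monomial_qsym \<alpha>))) m" by simp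
qed

definition xy_tensor :: "nat \<Rightarrow> xy_var power_series \<Rightarrow> (qsym, qsym) tensor"
  where "xy_tensor d h = (\<Sum>\<alpha>\<in>compositions d. \<Sum>\<beta>\<in>compositions d.
    int_scale (coeff h (xy_monom (std_monom \<alpha>) (std_monom \<beta>))) (monomial_qsym \<alpha> \<otimes> monomial_qsym \<beta>))"

lemma additive_pure_left: "additive (\<lambda>a. a \<otimes> b)" and additive_pure_right: "additive ((\<otimes>) a)"
  by (auto simp: additive_def pure_tensor_add_left pure_tensor_add_right)

lemma int_scale_mult: "int_scale (j * k) a = int_scale j (int_scale k a)"
proof -
  have "additive (\<lambda>j. int_scale (j * k) a)" "additive (\<lambda>j. int_scale j (int_scale k a))"
    by (auto simp: additive_def distrib_right int_scale_add)
  from additive_int_scale [OF this(1), of j 1] additive_int_scale [OF this(2), of j 1]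
  show ?thesis by simp
qed

lemma xy_tensor_product:
  assumes "\<And>m. coeff (series_of_qsym a) m \<noteq> 0 \<Longrightarrow> mdegree m \<le> d"
    and "\<And>m. coeff (series_of_qsym b) m \<noteq> 0 \<Longrightarrow> mdegree m \<le> d"
  shows "xy_tensor d (xy_product a b) = a \<otimes> b"
proof -
  let ?a = "\<lambda>\<alpha>. int_scale (coeff (series_of_qsym a) (std_monom \<alpha>)) (monomial_qsym \<alpha>)"
  let ?b = "\<lambda>\<alpha>. int_scale (coeff (series_of_qsym b) (std_monom \<alpha>)) (monomial_qsym \<alpha>)"
  have "a \<otimes> b = (\<Sum>\<alpha>\<in>compositions d. ?a \<alpha>) \<otimes> (\<Sum>\<beta>\<in>compositions d. ?b \<beta>)"
    using qsym_expansion [of a d] qsym_expansion [of b d] assms by metis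
  also have "\<dots> = (\<Sum>\<alpha>\<in>compositions d. \<Sum>\<beta>\<in>compositions d. ?a \<alpha> \<otimes> ?b \<beta>)"
    by (subst additive.sum [OF additive_pure_left]) (simp add: additive.sum [OF additive_pure_right])
  also have "\<dots> = xy_tensor d (xy_product a b)"
    unfolding xy_tensor_def coeff_xy_mult
    by (simp add: additive_int_scale [OF additive_pure_left]
        additive_int_scale [OF additive_pure_right] mult.commute flip: int_scale_mult)
  finally show ?thesis ..
qed

lemma additive_xy_tensor: "additive (xy_tensor d)"
  by standard (simp add: xy_tensor_def plus_power_series.rep_eq int_scale_add sum.distrib)

lemma xy_tensor_sum_list:
  "\<exists>d. \<forall>d'\<ge>d. xy_tensor d' (\<Sum>(a, b)\<leftarrow>ghs. xy_product a b) = (\<Sum>(a, b)\<leftarrow>ghs. a \<otimes> b)"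
proof (induction ghs)
  case Nil
  show ?case by (simp add: additive.zero [OF additive_xy_tensor])
next
  case (Cons gh ghs)
  obtain a b where gh: "gh = (a, b)" by (cases gh)
  from Cons obtain d where
    d: "\<And>d'. d \<le> d' \<Longrightarrow> xy_tensor d' (\<Sum>(a, b)\<leftarrow>ghs. xy_product a b) = (\<Sum>(a, b)\<leftarrow>ghs. a \<otimes> b)"
    by blast
  obtain i where i: "\<And>m. coeff (series_of_qsym a) m \<noteq> 0 \<Longrightarrow> mdegree m \<le> i"
    using quasisymmetric_degree [OF quasisymmetric_series_of_qsym] by blast
  obtain j where j: "\<And>m. coeff (series_of_qsym b) m \<noteq> 0 \<Longrightarrow> mdegree m \<le> j"
    using quasisymmetric_degree [OF quasisymmetric_series_of_qsym] by blast
  have "xy_tensor d' (xy_product a b) = a \<otimes> b" if "max d (max i j) \<le> d'" for d'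
    by (rule xy_tensor_product) (use i j that in \<open>fastforce+\<close>)
  then show ?case
    by (intro exI [of _ "max d (max i j)"])
      (simp add: gh additive.add [OF additive_xy_tensor] d)
qed

lemma xy_product_int_scale:
  "coeff (xy_product (int_scale k a) b) (xy_monom m n) =
    k * coeff (series_of_qsym a) m * coeff (series_of_qsym b) n"
  by (simp add: coeff_xy_mult additive_int_scale [OF additive_coeff_qsym])

lemma coeff_sum: "coeff (sum f S) m = (\<Sum>s\<in>S. coeff (f s) m)"
  by (induction S rule: infinite_finite_induct)
    (simp_all add: zero_power_series.rep_eq plus_power_series.rep_eq)

lemma ex1_qsym_comult:
  "\<exists>!t. \<exists>ghs. xy_extension g = (\<Sum>(a, b)\<leftarrow>ghs. xy_product a b) \<and> t = (\<Sum>(a, b)\<leftarrow>ghs. a \<otimes> b)"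
proof (rule ex_ex1I)
  let ?h = "xy_extension g"
  obtain d where d: "\<And>m. coeff ?h m \<noteq> 0 \<Longrightarrow> mdegree m \<le> d"
    using quasisymmetric_degree [OF xy_extension(1)] by blast
  let ?c = "\<lambda>\<alpha> \<beta>. coeff ?h (xy_monom (std_monom \<alpha>) (std_monom \<beta>))"
  obtain ps where ps: "set ps = compositions d \<times> compositions d" "distinct ps"
    using finite_distinct_list [of "compositions d \<times> compositions d"] by auto
  let ?ghs = "map (\<lambda>(\<alpha>, \<beta>). (int_scale (?c \<alpha> \<beta>) (monomial_qsym \<alpha>), monomial_qsym \<beta>)) ps"
  have "?h = (\<Sum>(a, b)\<leftarrow>?ghs. xy_product a b)"
  proof (rule power_series_eqI)
    fix u
    obtain m n where u: "u = xy_monom m n" using ex_xy_monom by blast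
    have "(\<Sum>(a, b)\<leftarrow>?ghs. xy_product a b) =
        (\<Sum>(\<alpha>, \<beta>)\<in>compositions d \<times> compositions d.
          xy_product (int_scale (?c \<alpha> \<beta>) (monomial_qsym \<alpha>)) (monomial_qsym \<beta>))"
      using ps by (simp add: split_def comp_def flip: sum_list_distinct_conv_sum_set ps(1))
    then have "coeff (\<Sum>(a, b)\<leftarrow>?ghs. xy_product a b) u =
        (\<Sum>(\<alpha>, \<beta>)\<in>compositions d \<times> compositions d. ?c \<alpha> \<beta> *
          (if exponents m = \<alpha> then 1 else 0) * (if exponents n = \<beta> then 1 else 0))"
      unfolding u by (simp only: coeff_sum split_def xy_product_int_scale coeff_monomial_qsym)
    also have "\<dots> = (\<Sum>p\<in>compositions d \<times> compositions d.
        if p = (exponents m, exponents n) then ?c (exponents m) (exponents n) else 0)"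
      by (intro sum.cong) (auto split: if_splits)
    also have "\<dots> = (if exponents m \<in> compositions d \<and> exponents n \<in> compositions d
        then ?c (exponents m) (exponents n) else 0)"
      by simp
    also have "?c (exponents m) (exponents n) = coeff ?h u"
      unfolding u by (rule coeff_exponents_cong [OF xy_extension(1)])
        (simp add: exponents_xy_monom exponents_std_monom exponents_pos)
    also have "(if exponents m \<in> compositions d \<and> exponents n \<in> compositions d
        then coeff ?h u else 0) = coeff ?h u"
    proof (cases "coeff ?h u = 0")
      case False
      then have "mdegree m + mdegree n \<le> d"
        using d [OF False] exponents_xy_monom [of m n] by (metis u sum_list_exponents sum_list_append)
      then show ?thesis by (simp add: compositions_def exponents_pos sum_list_exponents)
    qed simp
    finally show "coeff ?h u = coeff (\<Sum>(a, b)\<leftarrow>?ghs. xy_product a b) u" ..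
  qed
  then show "\<exists>t ghs. ?h = (\<Sum>(a, b)\<leftarrow>ghs. xy_product a b) \<and> t = (\<Sum>(a, b)\<leftarrow>ghs. a \<otimes> b)"
    by blast
next
  fix s t
  assume
    "\<exists>ghs. xy_extension g = (\<Sum>(a, b)\<leftarrow>ghs. xy_product a b) \<and> s = (\<Sum>(a, b)\<leftarrow>ghs. a \<otimes> b)"
    "\<exists>ghs. xy_extension g = (\<Sum>(a, b)\<leftarrow>ghs. xy_product a b) \<and> t = (\<Sum>(a, b)\<leftarrow>ghs. a \<otimes> b)"
  then obtain d e where "\<forall>d'\<ge>d. xy_tensor d' (xy_extension g) = s"
    "\<forall>d'\<ge>e. xy_tensor d' (xy_extension g) = t"
    using xy_tensor_sum_list by metis
  then show "s = t" by (metis max.cobounded1 max.cobounded2)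
qed

definition is_matroid :: "'a set \<Rightarrow> 'a set set \<Rightarrow> bool"
  where "is_matroid E I \<longleftrightarrow>
    finite E \<and> I \<subseteq> Pow E \<and> {} \<in> I \<and> (\<forall>X\<in>I. \<forall>Y. Y \<subseteq> X \<longrightarrow> Y \<in> I) \<and>
    (\<forall>X\<in>I. \<forall>Y\<in>I. card X < card Y \<longrightarrow> (\<exists>y\<in>Y - X. insert y X \<in> I))"

typedef 'a matroid = "{(E :: 'a set, I). is_matroid E I}"
  by (rule exI [of _ "({}, {{}})"]) (simp add: is_matroid_def)

setup_lifting type_definition_matroid

lift_definition ground :: "'a matroid \<Rightarrow> 'a set" is fst .

lift_definition indeps :: "'a matroid \<Rightarrow> 'a set set" is snd .

definition bases :: "'a matroid \<Rightarrow> 'a set set"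
  where "bases M = {B \<in> indeps M. \<forall>X\<in>indeps M. B \<subseteq> X \<longrightarrow> X = B}"

lemma is_matroid_augment:
  "is_matroid E I \<Longrightarrow> X \<in> I \<Longrightarrow> Y \<in> I \<Longrightarrow> card X < card Y \<Longrightarrow> \<exists>y\<in>Y - X. insert y X \<in> I"
  by (simp add: is_matroid_def)

lemma is_matroid_hereditary: "is_matroid E I \<Longrightarrow> X \<in> I \<Longrightarrow> Y \<subseteq> X \<Longrightarrow> Y \<in> I"
  unfolding is_matroid_def by blast

lemma is_matroid_subset: "is_matroid E I \<Longrightarrow> X \<in> I \<Longrightarrow> X \<subseteq> E"
  unfolding is_matroid_def by blast

lemma matroid_eqI: "ground M = ground N \<Longrightarrow> indeps M = indeps N \<Longrightarrow> M = N"
  by transfer (auto simp: prod_eq_iff)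

lemma is_matroid: "is_matroid (ground M) (indeps M)"
  by transfer auto

lemma finite_ground [simp]: "finite (ground M)"
  and indeps_subset_ground: "X \<in> indeps M \<Longrightarrow> X \<subseteq> ground M"
  and empty_indep [simp]: "{} \<in> indeps M"
  and indep_subset: "X \<in> indeps M \<Longrightarrow> Y \<subseteq> X \<Longrightarrow> Y \<in> indeps M"
  and indep_augment: "X \<in> indeps M \<Longrightarrow> Y \<in> indeps M \<Longrightarrow> card X < card Y \<Longrightarrow>
    \<exists>y\<in>Y - X. insert y X \<in> indeps M"
  using is_matroid [of M] unfolding is_matroid_def by blast+

lemma finite_indep: "X \<in> indeps M \<Longrightarrow> finite X"
  using indeps_subset_ground finite_subset finite_ground by metis

lemma indep_extends_to_base:
  assumes "X \<in> indeps M"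
  shows "\<exists>B\<in>bases M. X \<subseteq> B"
proof -
  have "finite (indeps M)"
    by (rule finite_subset [of _ "Pow (ground M)"]) (auto dest: indeps_subset_ground)
  from finite_has_maximal2 [OF this assms] show ?thesis by (auto simp: bases_def)
qed

lemma bases_nonempty: "bases M \<noteq> {}"
  using indep_extends_to_base [OF empty_indep, of M] by blast

lemma base_indep: "B \<in> bases M \<Longrightarrow> B \<in> indeps M"
  by (simp add: bases_def)

lemma card_indep_le_base: "X \<in> indeps M \<Longrightarrow> B \<in> bases M \<Longrightarrow> card X \<le> card B"
  using indep_augment [of B M X] unfolding bases_def by fastforce

lemma card_bases: "B \<in> bases M \<Longrightarrow> B' \<in> bases M \<Longrightarrow> card B = card B'"
  by (meson card_indep_le_base base_indep le_antisym)

lemma baseI: "X \<in> indeps M \<Longrightarrow> B \<in> bases M \<Longrightarrow> card X = card B \<Longrightarrow> X \<in> bases M"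
  by (metis card_bases card_subset_eq finite_indep indep_extends_to_base base_indep)

lift_definition restriction :: "'a matroid \<Rightarrow> 'a set \<Rightarrow> 'a matroid"
  is "\<lambda>(E, I) A. (E \<inter> A, {X \<in> I. X \<subseteq> A})"
proof clarify
  fix E :: "'a set" and I A
  assume M: "is_matroid E I"
  show "is_matroid (E \<inter> A) {X \<in> I. X \<subseteq> A}"
    unfolding is_matroid_def
  proof (intro conjI ballI impI)
    fix X Y assume XY: "X \<in> {X \<in> I. X \<subseteq> A}" "Y \<in> {X \<in> I. X \<subseteq> A}" "card X < card Y"
    then obtain y where "y \<in> Y - X" "insert y X \<in> I"
      using is_matroid_augment [OF M, of X Y] by blast
    with XY show "\<exists>y\<in>Y - X. insert y X \<in> {X \<in> I. X \<subseteq> A}" by blast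
  qed (use M in \<open>auto simp: is_matroid_def\<close>)
qed

lemma ground_restriction [simp]: "ground (restriction M A) = ground M \<inter> A"
  by transfer auto

lemma indeps_restriction [simp]: "indeps (restriction M A) = {X \<in> indeps M. X \<subseteq> A}"
  by transfer auto

lemma is_matroid_contraction:
  "is_matroid (ground M - A)
    {X. X \<subseteq> ground M - A \<and> (\<exists>J\<in>bases (restriction M A). X \<union> J \<in> indeps M)}"
  (is "is_matroid _ ?I")
  unfolding is_matroid_def
proof (intro conjI ballI allI impI)
  show "{} \<in> ?I"
  proof -
    obtain J where J: "J \<in> bases (restriction M A)"
      using bases_nonempty [of "restriction M A"] by blast
    then have "J \<in> indeps M" using base_indep by fastforce
    with J show ?thesis by auto
  qed
  fix X assume X: "X \<in> ?I"
  show "Y \<in> ?I" if "Y \<subseteq> X" for Y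
  proof -
    from X obtain J where "J \<in> bases (restriction M A)" "X \<union> J \<in> indeps M" by blast
    moreover from this that have "Y \<union> J \<in> indeps M" by (elim indep_subset) blast
    ultimately show ?thesis using X that by blast
  qed
  fix Y assume Y: "Y \<in> ?I" and card: "card X < card Y"
  from X obtain J where J: "J \<in> bases (restriction M A)" "X \<union> J \<in> indeps M" by blast
  from Y obtain K where K: "K \<in> bases (restriction M A)" "Y \<union> K \<in> indeps M" by blast
  from J K have JA: "J \<subseteq> A" and KA: "K \<subseteq> A" by (auto simp: bases_def)
  have "card (X \<union> J) = card X + card J" "card (Y \<union> K) = card Y + card K"
    using X Y JA KA J K finite_indep by (auto intro!: card_Un_disjoint dest: finite_indep)
  with card card_bases [OF J(1) K(1)] have "card (X \<union> J) < card (Y \<union> K)" by simp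
  from indep_augment [OF J(2) K(2) this] obtain y
    where y: "y \<in> (Y \<union> K) - (X \<union> J)" "insert y (X \<union> J) \<in> indeps M" by blast
  have "y \<notin> K"
  proof
    assume "y \<in> K"
    then have "insert y J \<in> indeps (restriction M A)"
      using JA KA indep_subset [OF y(2), of "insert y J"] by auto
    with J(1) have "insert y J = J" unfolding bases_def by blast
    with y show False by blast
  qed
  with y show "\<exists>y\<in>Y - X. insert y X \<in> ?I"
    using X Y J by auto
qed auto

definition contraction :: "'a matroid \<Rightarrow> 'a set \<Rightarrow> 'a matroid"
  where "contraction M A = Abs_matroid (ground M - A,
    {X. X \<subseteq> ground M - A \<and> (\<exists>J\<in>bases (restriction M A). X \<union> J \<in> indeps M)})"

lemma ground_contraction [simp]: "ground (contraction M A) = ground M - A"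
  and indeps_contraction: "indeps (contraction M A) =
    {X. X \<subseteq> ground M - A \<and> (\<exists>J\<in>bases (restriction M A). X \<union> J \<in> indeps M)}"
  using is_matroid_contraction [of M A]
  by (simp_all add: contraction_def ground.rep_eq indeps.rep_eq Abs_matroid_inverse)

lemma Plus_vimage: "Inl -` W <+> Inr -` W = W"
proof (rule set_eqI)
  fix s :: "'a + 'b"
  show "s \<in> Inl -` W <+> Inr -` W \<longleftrightarrow> s \<in> W" by (cases s) auto
qed

lift_definition direct_sum :: "'a matroid \<Rightarrow> 'b matroid \<Rightarrow> ('a + 'b) matroid"
  is "\<lambda>(E, I) (E', I'). (E <+> E', {X <+> X' | X X'. X \<in> I \<and> X' \<in> I'})"
proof clarify
  fix E :: "'a set" and I and E' :: "'b set" and I'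
  assume M: "is_matroid E I" and M': "is_matroid E' I'"
  let ?I = "{X <+> X' | X X'. X \<in> I \<and> X' \<in> I'}"
  have fin: "finite X" if "X \<in> I" for X
    using is_matroid_subset [OF M that] M by (simp add: is_matroid_def finite_subset)
  have fin': "finite X" if "X \<in> I'" for X
    using is_matroid_subset [OF M' that] M' by (simp add: is_matroid_def finite_subset)
  show "is_matroid (E <+> E') ?I"
    unfolding is_matroid_def
  proof (intro conjI ballI allI impI)
    show "finite (E <+> E')" using M M' by (simp add: is_matroid_def)
    show "?I \<subseteq> Pow (E <+> E')"
      using is_matroid_subset [OF M] is_matroid_subset [OF M'] by blast
    have "{} \<in> I" "{} \<in> I'" using M M' by (simp_all add: is_matroid_def)
    then show "{} \<in> ?I" by (force intro: exI [of _ "{}"])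
    fix Z assume "Z \<in> ?I"
    then obtain X X' where Z: "Z = X <+> X'" "X \<in> I" "X' \<in> I'" by blast
    show "W \<in> ?I" if "W \<subseteq> Z" for W
    proof -
      have "Inl -` W \<subseteq> X" "Inr -` W \<subseteq> X'" using that Z by auto
      then have "Inl -` W \<in> I" "Inr -` W \<in> I'"
        using Z is_matroid_hereditary [OF M] is_matroid_hereditary [OF M'] by simp_all
      then show ?thesis using Plus_vimage [of W] by (metis (mono_tags, lifting) mem_Collect_eq)

    qed
    fix W assume "W \<in> ?I" and card: "card Z < card W"
    then obtain Y Y' where W: "W = Y <+> Y'" "Y \<in> I" "Y' \<in> I'" by blast
    have "card X + card X' < card Y + card Y'"
      using card Z W by (simp add: card_Plus fin fin')
    then consider "card X < card Y" | "card X' < card Y'" by linarith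
    then show "\<exists>y\<in>W - Z. insert y Z \<in> ?I"
    proof cases
      case 1
      then obtain y where y: "y \<in> Y - X" "insert y X \<in> I"
        using is_matroid_augment [OF M, of X Y] Z W by blast
      have "insert (Inl y) Z = insert y X <+> X'" using Z by auto
      with y Z W show ?thesis by (intro bexI [of _ "Inl y"]) auto
    next
      case 2
      then obtain y where y: "y \<in> Y' - X'" "insert y X' \<in> I'"
        using is_matroid_augment [OF M', of X' Y'] Z W by blast
      have "insert (Inr y) Z = X <+> insert y X'" using Z by auto
      with y Z W show ?thesis by (intro bexI [of _ "Inr y"]) auto
    qed
  qed
qed

lemma ground_direct_sum [simp]: "ground (direct_sum M N) = ground M <+> ground N"
  by transfer auto

lemma indeps_direct_sum:
  "indeps (direct_sum M N) = {X <+> Y | X Y. X \<in> indeps M \<and> Y \<in> indeps N}"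
  by transfer (simp add: split_beta)

lemma mem_indeps_direct_sum:
  "Z \<in> indeps (direct_sum M N) \<longleftrightarrow> Inl -` Z \<in> indeps M \<and> Inr -` Z \<in> indeps N"
proof -
  have "Inl -` (X <+> Y) = X" "Inr -` (X <+> Y) = Y" for X :: "'a set" and Y :: "'b set"
    by auto
  then show ?thesis unfolding indeps_direct_sum using Plus_vimage [of Z] by auto metis
qed

lift_definition empty_matroid :: "'a matroid" is "({}, {{}})"
  by (simp add: is_matroid_def)

lemma ground_empty_matroid [simp]: "ground empty_matroid = {}"
  and indeps_empty_matroid [simp]: "indeps empty_matroid = {{}}"
  by (transfer; simp)+

definition matroid_iso :: "('a \<Rightarrow> 'b) \<Rightarrow> 'a matroid \<Rightarrow> 'b matroid \<Rightarrow> bool"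
  where "matroid_iso h M N \<longleftrightarrow> bij_betw h (ground M) (ground N) \<and>
    (\<forall>X\<subseteq>ground M. X \<in> indeps M \<longleftrightarrow> h ` X \<in> indeps N)"

definition isomorphic :: "'a matroid \<Rightarrow> 'b matroid \<Rightarrow> bool" (infix \<open>\<cong>\<^sub>M\<close> 50)
  where "M \<cong>\<^sub>M N \<longleftrightarrow> (\<exists>h. matroid_iso h M N)"

lemma isomorphic_refl [simp]: "M \<cong>\<^sub>M M"
  unfolding isomorphic_def matroid_iso_def by (rule exI [of _ id]) simp

lemma matroid_iso_inv:
  assumes "matroid_iso h M N"
  shows "matroid_iso (inv_into (ground M) h) N M"
  unfolding matroid_iso_def
proof (intro conjI allI impI)
  from assms have h: "bij_betw h (ground M) (ground N)" by (simp add: matroid_iso_def)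
  then show "bij_betw (inv_into (ground M) h) (ground N) (ground M)"
    by (rule bij_betw_inv_into)
  fix X assume X: "X \<subseteq> ground N"
  then have "h ` inv_into (ground M) h ` X = X"
    using h by (simp add: bij_betw_def image_inv_into_cancel)
  moreover have "inv_into (ground M) h ` X \<subseteq> ground M"
    using X h by (metis bij_betw_imp_surj_on image_subsetI inv_into_into subsetD)
  ultimately show "X \<in> indeps N \<longleftrightarrow> inv_into (ground M) h ` X \<in> indeps M"
    using assms by (simp add: matroid_iso_def)
qed

lemma isomorphic_sym: "M \<cong>\<^sub>M N \<Longrightarrow> N \<cong>\<^sub>M M"
  unfolding isomorphic_def using matroid_iso_inv by blast

lemma matroid_iso_comp:
  assumes "matroid_iso h M N" "matroid_iso k N P"
  shows "matroid_iso (k \<circ> h) M P"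
proof -
  have "h ` X \<subseteq> ground N" if "X \<subseteq> ground M" for X
    using that assms by (auto simp: matroid_iso_def bij_betw_def)
  then show ?thesis
    using assms unfolding matroid_iso_def image_comp [symmetric] by (metis bij_betw_trans)
qed

lemma isomorphic_trans: "M \<cong>\<^sub>M N \<Longrightarrow> N \<cong>\<^sub>M P \<Longrightarrow> M \<cong>\<^sub>M P"
  unfolding isomorphic_def using matroid_iso_comp by blast

lemma ex_isomorphic_image:
  assumes h: "inj_on h (ground M)"
  shows "\<exists>N. matroid_iso h M N"
proof -
  let ?E = "h ` ground M" and ?I = "(`) h ` indeps M"
  have card: "card (h ` X) = card X" if "X \<in> indeps M" for X
    using that h by (meson card_image indeps_subset_ground inj_on_subset)
  have "is_matroid ?E ?I"
    unfolding is_matroid_def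
  proof (intro conjI ballI allI impI)
    show "?I \<subseteq> Pow ?E" using indeps_subset_ground by blast
    fix Z assume "Z \<in> ?I"
    then obtain X where X: "X \<in> indeps M" "Z = h ` X" by blast
    show "W \<in> ?I" if "W \<subseteq> Z" for W
      using that X by (metis imageI indep_subset subset_imageE)
    fix W assume "W \<in> ?I" "card Z < card W"
    then obtain Y where Y: "Y \<in> indeps M" "W = h ` Y" by blast
    with X card \<open>card Z < card W\<close> have "card X < card Y" by simp
    with X Y obtain y where y: "y \<in> Y - X" "insert y X \<in> indeps M"
      using indep_augment by blast
    have "h y \<notin> h ` X"
      using h y X Y indeps_subset_ground by (metis DiffD1 DiffD2 inj_on_image_mem_iff subsetD)
    then show "\<exists>y\<in>W - Z. insert y Z \<in> ?I"
      using X Y y by (intro bexI [of _ "h y"]) (auto simp flip: image_insert)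
  qed auto
  then have N: "ground (Abs_matroid (?E, ?I)) = ?E" "indeps (Abs_matroid (?E, ?I)) = ?I"
    by (simp_all add: ground.rep_eq indeps.rep_eq Abs_matroid_inverse)
  have "X \<in> indeps M" if "X \<subseteq> ground M" "h ` X \<in> ?I" for X
  proof -
    from that obtain Y where "Y \<in> indeps M" "h ` X = h ` Y" by blast
    with that(1) show ?thesis
      using inj_on_image_eq_iff [OF h, of X Y] indeps_subset_ground by metis
  qed
  then have "matroid_iso h M (Abs_matroid (?E, ?I))"
    unfolding matroid_iso_def N using h by (auto simp: bij_betw_def)
  then show ?thesis by blast
qed

lemma ex_isomorphic_nat: "\<exists>N :: nat matroid. M \<cong>\<^sub>M N"
proof -
  obtain h :: "'a \<Rightarrow> nat" where "inj_on h (ground M)"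
    using finite_imp_inj_to_nat_seg [OF finite_ground, of M] by blast
  then show ?thesis
    using ex_isomorphic_image unfolding isomorphic_def by blast
qed

definition nat_copy :: "'a matroid \<Rightarrow> nat matroid"
  where "nat_copy M = (SOME N. M \<cong>\<^sub>M N)"

lemma isomorphic_nat_copy: "M \<cong>\<^sub>M nat_copy M"
  unfolding nat_copy_def using ex_isomorphic_nat by (rule someI_ex)

lemma nat_copy_cong: "M \<cong>\<^sub>M N \<Longrightarrow> nat_copy M \<cong>\<^sub>M nat_copy N"
  using isomorphic_nat_copy isomorphic_sym isomorphic_trans by metis

lemma isomorphic_direct_sum:
  assumes "M \<cong>\<^sub>M M'" "N \<cong>\<^sub>M N'"
  shows "direct_sum M N \<cong>\<^sub>M direct_sum M' N'"
proof -
  from assms obtain h k where h: "matroid_iso h M M'" and k: "matroid_iso k N N'"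
    unfolding isomorphic_def by blast
  have "matroid_iso (map_sum h k) (direct_sum M N) (direct_sum M' N')"
    unfolding matroid_iso_def
  proof (intro conjI allI impI)
    show "bij_betw (map_sum h k) (ground (direct_sum M N)) (ground (direct_sum M' N'))"
    proof -
      have hk: "inj_on h (ground M)" "h ` ground M = ground M'"
        "inj_on k (ground N)" "k ` ground N = ground N'"
        using h k by (simp_all add: matroid_iso_def bij_betw_def)
      have "map_sum h k ` (ground M <+> ground N) = h ` ground M <+> k ` ground N"
        by (simp add: Plus_def image_Un image_image)
      moreover have "inj_on (map_sum h k) (ground M <+> ground N)"
      proof (rule inj_onI)
        fix s t
        assume "s \<in> ground M <+> ground N" "t \<in> ground M <+> ground N"
          "map_sum h k s = map_sum h k t"
        then show "s = t"
          using inj_onD [OF hk(1)] inj_onD [OF hk(3)] by (cases s; cases t) auto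
      qed
      ultimately show ?thesis using hk by (simp add: bij_betw_def)
    qed
    fix Z assume Z: "Z \<subseteq> ground (direct_sum M N)"
    have "map_sum h k ` (Inl -` Z <+> Inr -` Z) = h ` (Inl -` Z) <+> k ` (Inr -` Z)"
      unfolding Plus_def image_Un image_comp by (simp add: comp_def)
    then have "map_sum h k ` Z = h ` (Inl -` Z) <+> k ` (Inr -` Z)"
      unfolding Plus_vimage .
    then have "Inl -` map_sum h k ` Z = h ` (Inl -` Z)" "Inr -` map_sum h k ` Z = k ` (Inr -` Z)"
      by auto
    moreover have "Inl -` Z \<subseteq> ground M" "Inr -` Z \<subseteq> ground N" using Z by auto
    ultimately show "Z \<in> indeps (direct_sum M N) \<longleftrightarrow>
        map_sum h k ` Z \<in> indeps (direct_sum M' N')"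
      using h k by (simp add: mem_indeps_direct_sum matroid_iso_def)
  qed
  then show ?thesis unfolding isomorphic_def by blast
qed

text \<open>Every matroid here has a finite ground set, hence is isomorphic to one on natural numbers, and
  these represent all isomorphism classes.\<close>

quotient_type matroid_class = "nat matroid" / "isomorphic :: nat matroid \<Rightarrow> nat matroid \<Rightarrow> bool"
  by (rule equivpI)
    (auto simp: reflp_def symp_def transp_def intro: isomorphic_sym isomorphic_trans)

definition mclass :: "'a matroid \<Rightarrow> matroid_class"
  where "mclass M = abs_matroid_class (nat_copy M)"

lemma mclass_eq_iff: "mclass M = mclass N \<longleftrightarrow> M \<cong>\<^sub>M N"
  unfolding mclass_def matroid_class.abs_eq_iff
  using isomorphic_nat_copy isomorphic_sym isomorphic_trans by metis

lemma mclass_nat: "mclass M = abs_matroid_class M"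
  unfolding mclass_def matroid_class.abs_eq_iff using isomorphic_nat_copy isomorphic_sym by blast

instantiation matroid_class :: comm_monoid_add
begin

lift_definition zero_matroid_class :: matroid_class is empty_matroid .

lift_definition plus_matroid_class :: "matroid_class \<Rightarrow> matroid_class \<Rightarrow> matroid_class"
  is "\<lambda>M N. nat_copy (direct_sum M N)"
  by (intro nat_copy_cong isomorphic_direct_sum)

instance
proof
  fix a b c :: matroid_class
  show "a + b + c = a + (b + c)"
  proof transfer
    fix M N P :: "nat matroid"
    let ?h = "\<lambda>s :: (nat + nat) + nat.
      case s of Inl (Inl x) \<Rightarrow> Inl x | Inl (Inr y) \<Rightarrow> Inr (Inl y) | Inr z \<Rightarrow> Inr (Inr z)"
    have "matroid_iso ?h (direct_sum (direct_sum M N) P) (direct_sum M (direct_sum N P))"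
      unfolding matroid_iso_def
    proof (intro conjI allI impI)
      show "bij_betw ?h (ground (direct_sum (direct_sum M N) P)) (ground (direct_sum M (direct_sum N P)))"
        by (rule bij_betw_byWitness [where f' = "\<lambda>s. case s of Inl x \<Rightarrow> Inl (Inl x) |
              Inr (Inl y) \<Rightarrow> Inl (Inr y) | Inr (Inr z) \<Rightarrow> Inr z"]) (auto split: sum.splits)
      fix Z
      have "Inl -` ?h ` Z = Inl -` Inl -` Z" "Inl -` Inr -` ?h ` Z = Inr -` Inl -` Z"
           "Inr -` Inr -` ?h ` Z = Inr -` Z"
        by (auto split: sum.splits simp: image_iff) force+
      then show "Z \<in> indeps (direct_sum (direct_sum M N) P) \<longleftrightarrow>
          ?h ` Z \<in> indeps (direct_sum M (direct_sum N P))"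
        by (simp add: mem_indeps_direct_sum)
    qed
    then have "direct_sum (direct_sum M N) P \<cong>\<^sub>M direct_sum M (direct_sum N P)"
      unfolding isomorphic_def by blast
    then show "nat_copy (direct_sum (nat_copy (direct_sum M N)) P)
        \<cong>\<^sub>M nat_copy (direct_sum M (nat_copy (direct_sum N P)))"
      by (meson isomorphic_direct_sum isomorphic_nat_copy isomorphic_refl isomorphic_sym
          isomorphic_trans nat_copy_cong)
  qed
  show "a + b = b + a"
  proof transfer
    fix M N :: "nat matroid"
    let ?h = "case_sum Inr Inl :: nat + nat \<Rightarrow> nat + nat"
    have "matroid_iso ?h (direct_sum M N) (direct_sum N M)"
      unfolding matroid_iso_def
    proof (intro conjI allI impI)
      show "bij_betw ?h (ground (direct_sum M N)) (ground (direct_sum N M))"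
        by (rule bij_betw_byWitness [where f' = "case_sum Inr Inl"]) (auto split: sum.splits)
      fix Z
      have "Inl -` ?h ` Z = Inr -` Z" "Inr -` ?h ` Z = Inl -` Z"
        by (auto split: sum.splits simp: image_iff) force+
      then show "Z \<in> indeps (direct_sum M N) \<longleftrightarrow> ?h ` Z \<in> indeps (direct_sum N M)"
        by (auto simp: mem_indeps_direct_sum)
    qed
    then show "nat_copy (direct_sum M N) \<cong>\<^sub>M nat_copy (direct_sum N M)"
      by (intro nat_copy_cong) (auto simp: isomorphic_def)
  qed
  show "0 + a = a"
  proof transfer
    fix M :: "nat matroid"
    have "matroid_iso Inr M (direct_sum (empty_matroid :: nat matroid) M)"
      unfolding matroid_iso_def
    proof (intro conjI allI impI)
      show "bij_betw Inr (ground M) (ground (direct_sum (empty_matroid :: nat matroid) M))"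
        by (auto simp: bij_betw_def)
      fix X :: "nat set"
      have "Inl -` (Inr ` X :: (nat + nat) set) = {}" "Inr -` (Inr ` X :: (nat + nat) set) = X"
        by auto
      then show "X \<in> indeps M \<longleftrightarrow>
          Inr ` X \<in> indeps (direct_sum (empty_matroid :: nat matroid) M)"
        by (simp add: mem_indeps_direct_sum)
    qed
    then have "M \<cong>\<^sub>M direct_sum (empty_matroid :: nat matroid) M"
      unfolding isomorphic_def by blast
    then have "direct_sum (empty_matroid :: nat matroid) M \<cong>\<^sub>M M"
      by (rule isomorphic_sym)
    then show "nat_copy (direct_sum (empty_matroid :: nat matroid) M) \<cong>\<^sub>M M"
      by (rule isomorphic_trans [OF isomorphic_sym [OF isomorphic_nat_copy]])
  qed
qed

end

lemma mclass_direct_sum: "mclass (direct_sum M N) = mclass M + mclass N"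
  unfolding mclass_def plus_matroid_class.abs_eq matroid_class.abs_eq_iff
  by (intro nat_copy_cong isomorphic_direct_sum isomorphic_nat_copy)

lemma mclass_empty: "mclass M = 0 \<longleftrightarrow> ground M = {}"
proof -
  have "mclass M = 0 \<longleftrightarrow> M \<cong>\<^sub>M (empty_matroid :: nat matroid)"
    unfolding zero_matroid_class_def mclass_nat [symmetric] mclass_eq_iff by simp
  also have "\<dots> \<longleftrightarrow> ground M = {}"
    by (auto simp: isomorphic_def matroid_iso_def bij_betw_def)
  finally show ?thesis .
qed

text \<open>The free \<open>\<int>\<close>-module on the isomorphism classes. Its ring structure is that of the monoid ring of
  the classes under direct sum, see \<open>frag_of_mclass_mult\<close> and \<open>mat_one\<close> below.\<close>

type_synonym mat = "matroid_class \<Rightarrow>\<^sub>0 int"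

lemma frag_of_mclass_mult:
  "frag_of (mclass M) * frag_of (mclass N) = (frag_of (mclass (direct_sum M N)) :: mat)"
  by (simp add: mult_single mclass_direct_sum)

lemma mat_one: "(1 :: mat) = frag_of (mclass empty_matroid)"
  by (simp add: mclass_empty [THEN iffD2])

lemma matroid_iso_restriction:
  assumes h: "matroid_iso h M N"
  shows "matroid_iso h (restriction M A) (restriction N (h ` (ground M \<inter> A)))"
proof -
  have inj: "inj_on h (ground M)" and surj: "h ` ground M = ground N"
    and ind: "\<And>X. X \<subseteq> ground M \<Longrightarrow> X \<in> indeps M \<longleftrightarrow> h ` X \<in> indeps N"
    using h by (auto simp: matroid_iso_def bij_betw_def)
  show ?thesis
    unfolding matroid_iso_def
  proof (intro conjI allI impI)
    have "ground N \<inter> h ` (ground M \<inter> A) = h ` (ground M \<inter> A)" using surj by blast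
    then show "bij_betw h (ground (restriction M A)) (ground (restriction N (h ` (ground M \<inter> A))))"
      using inj by (simp add: bij_betw_def inj_on_Int)
    fix X assume "X \<subseteq> ground (restriction M A)"
    then have "X \<subseteq> ground M" "X \<subseteq> ground M \<inter> A" by auto
    then show "X \<in> indeps (restriction M A) \<longleftrightarrow>
        h ` X \<in> indeps (restriction N (h ` (ground M \<inter> A)))"
      using ind [of X] by auto
  qed
qed

lemma matroid_iso_bases:
  assumes h: "matroid_iso h M N" and X: "X \<subseteq> ground M"
  shows "X \<in> bases M \<longleftrightarrow> h ` X \<in> bases N"
proof -
  have inj: "inj_on h (ground M)" and surj: "h ` ground M = ground N"
    and ind: "\<And>X. X \<subseteq> ground M \<Longrightarrow> X \<in> indeps M \<longleftrightarrow> h ` X \<in> indeps N"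
    using h by (auto simp: matroid_iso_def bij_betw_def)
  have all: "(\<forall>Y\<in>indeps N. P Y) \<longleftrightarrow> (\<forall>Y\<in>indeps M. P (h ` Y))" for P
  proof
    assume "\<forall>Y\<in>indeps N. P Y"
    then show "\<forall>Y\<in>indeps M. P (h ` Y)" using ind indeps_subset_ground by blast
  next
    assume *: "\<forall>Y\<in>indeps M. P (h ` Y)"
    show "\<forall>Y\<in>indeps N. P Y"
    proof
      fix Y assume Y: "Y \<in> indeps N"
      then obtain Z where "Z \<subseteq> ground M" "Y = h ` Z"
        using surj indeps_subset_ground by (metis subset_imageE)
      with * Y ind show "P Y" by blast
    qed
  qed
  have "h ` X \<subseteq> h ` Y \<longleftrightarrow> X \<subseteq> Y" "h ` Y = h ` X \<longleftrightarrow> Y = X" if "Y \<in> indeps M" for Y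
    using inj_on_image_eq_iff [OF inj, of "X \<union> Y" Y] inj_on_image_eq_iff [OF inj, of Y X]
      X indeps_subset_ground [OF that] by (auto simp: image_Un)
  then show ?thesis
    unfolding bases_def mem_Collect_eq all using ind [OF X] by simp
qed

lemma matroid_iso_contraction:
  assumes h: "matroid_iso h M N" and A: "A \<subseteq> ground M"
  shows "matroid_iso h (contraction M A) (contraction N (h ` A))"
proof -
  have inj: "inj_on h (ground M)" and surj: "h ` ground M = ground N"
    and ind: "\<And>X. X \<subseteq> ground M \<Longrightarrow> X \<in> indeps M \<longleftrightarrow> h ` X \<in> indeps N"
    using h by (auto simp: matroid_iso_def bij_betw_def)
  have diff: "h ` (ground M - A) = ground N - h ` A"
    using inj surj A by (metis Diff_subset inj_on_image_set_diff order_refl)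
  have r: "matroid_iso h (restriction M A) (restriction N (h ` A))"
    using matroid_iso_restriction [OF h, of A] A by (simp add: Int_absorb1)
  have sub: "J \<subseteq> ground M \<inter> A" if "J \<in> bases (restriction M A)" for J
    using that indeps_subset_ground by (auto simp: bases_def)
  have sub': "J \<subseteq> h ` A" if "J \<in> bases (restriction N (h ` A))" for J
    using that by (auto simp: bases_def)
  have ex: "(\<exists>J\<in>bases (restriction N (h ` A)). P J) \<longleftrightarrow> (\<exists>J\<in>bases (restriction M A). P (h ` J))" for P
  proof
    assume "\<exists>J\<in>bases (restriction N (h ` A)). P J"
    then obtain J where J: "J \<in> bases (restriction N (h ` A))" "P J" by blast
    with sub' obtain K where "K \<subseteq> A" "J = h ` K" by (meson subset_imageE)
    moreover from this J A have "K \<in> bases (restriction M A)"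
      using matroid_iso_bases [OF r, of K] by auto
    ultimately show "\<exists>J\<in>bases (restriction M A). P (h ` J)" using J by blast
  next
    assume "\<exists>J\<in>bases (restriction M A). P (h ` J)"
    then show "\<exists>J\<in>bases (restriction N (h ` A)). P J"
      using matroid_iso_bases [OF r] sub by (metis ground_restriction)
  qed
  show ?thesis
    unfolding matroid_iso_def
  proof (intro conjI allI impI)
    show "bij_betw h (ground (contraction M A)) (ground (contraction N (h ` A)))"
      using inj diff by (auto simp: bij_betw_def intro: inj_on_subset)
    fix X assume "X \<subseteq> ground (contraction M A)"
    then have X: "X \<subseteq> ground M - A" by simp
    then have "h ` X \<subseteq> ground N - h ` A" using diff by blast
    moreover have "X \<union> J \<in> indeps M \<longleftrightarrow> h ` X \<union> h ` J \<in> indeps N"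
      if "J \<in> bases (restriction M A)" for J
      using ind [of "X \<union> J"] sub [OF that] X by (auto simp: image_Un)
    ultimately show "X \<in> indeps (contraction M A) \<longleftrightarrow> h ` X \<in> indeps (contraction N (h ` A))"
      using X unfolding indeps_contraction by (simp add: ex cong: bex_cong)
  qed
qed

definition minor_sum :: "'a matroid \<Rightarrow> (mat, mat) tensor"
  where "minor_sum M = (\<Sum>A\<in>Pow (ground M).
    frag_of (mclass (restriction M A)) \<otimes> frag_of (mclass (contraction M A)))"

lemma minor_sum_cong:
  assumes "M \<cong>\<^sub>M N"
  shows "minor_sum M = minor_sum N"
proof -
  from assms obtain h where h: "matroid_iso h M N" unfolding isomorphic_def by blast
  then have b: "bij_betw h (ground M) (ground N)" by (simp add: matroid_iso_def)
  have "mclass (restriction M A) = mclass (restriction N (h ` A))"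
    "mclass (contraction M A) = mclass (contraction N (h ` A))" if "A \<subseteq> ground M" for A
    using matroid_iso_restriction [OF h, of A] matroid_iso_contraction [OF h that] that
    unfolding mclass_eq_iff isomorphic_def by (auto simp: Int_absorb1)
  then show ?thesis
    unfolding minor_sum_def sum.reindex_bij_betw [OF bij_betw_Pow [OF b], symmetric]
    by (intro sum.cong) auto
qed

lift_definition class_comult :: "matroid_class \<Rightarrow> (mat, mat) tensor" is minor_sum
  by (rule minor_sum_cong)

lemma class_comult_mclass: "class_comult (mclass M) = minor_sum M"
  unfolding mclass_def class_comult.abs_eq
  by (rule minor_sum_cong [OF isomorphic_nat_copy, symmetric])

definition mat_comult :: "mat \<Rightarrow> (mat, mat) tensor"
  where "mat_comult = free_extend class_comult"

lemma mat_comult_mclass: "mat_comult (frag_of (mclass M)) = (\<Sum>A\<in>Pow (ground M).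
    frag_of (mclass (restriction M A)) \<otimes> frag_of (mclass (contraction M A)))"
  by (simp add: mat_comult_def class_comult_mclass minor_sum_def)

text \<open>The projection to degree \<open>0\<close>, which is spanned by the class \<open>0\<close> of the empty matroid.\<close>

definition mat_counit :: "mat \<Rightarrow> int"
  where "mat_counit p = Poly_Mapping.lookup p 0"

definition weight :: "('a \<Rightarrow> num) \<Rightarrow> 'a set \<Rightarrow> nat"
  where "weight f B = (\<Sum>e\<in>B. nat_of_num (f e))"

definition generic :: "'a matroid \<Rightarrow> ('a \<Rightarrow> num) \<Rightarrow> bool"
  where "generic M f \<longleftrightarrow> (\<exists>!B. B \<in> bases M \<and> (\<forall>B'\<in>bases M. weight f B \<le> weight f B'))"

text \<open>The coefficient of \<open>m\<close> counts the generic \<open>f\<close> whose monomial \<open>\<Prod>e. x\<^bsub>f(e)\<^esub>\<close> is \<open>m\<close>;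
  \<open>\<rightarrow>\<^sub>E\<close> makes functions on the ground set unique as total functions.\<close>

lift_definition F_series :: "'a matroid \<Rightarrow> num power_series"
  is "\<lambda>M m. int (card {f \<in> ground M \<rightarrow>\<^sub>E UNIV.
    generic M f \<and> (\<Sum>e\<in>ground M. Poly_Mapping.single (f e) 1) = m})" .

lemma card_exchange:
  assumes "finite B" "x \<in> B" "y \<notin> B"
  shows "card (insert y (B - {x})) = card B"
proof -
  have "card (insert y (B - {x})) = Suc (card (B - {x}))" using assms by simp
  also have "\<dots> = card B" using assms by (intro card.remove [symmetric])
  finally show ?thesis .
qed

lemma base_symmetric_exchange:
  assumes B: "B \<in> bases M" and B': "B' \<in> bases M" and y: "y \<in> B' - B"
  shows "\<exists>x\<in>B - B'. insert y (B - {x}) \<in> bases M \<and> insert x (B' - {y}) \<in> bases M"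
proof -
  note indB = base_indep [OF B] and indB' = base_indep [OF B']
  note finB = finite_indep [OF indB] and finB' = finite_indep [OF indB']
  define D where "D = {x \<in> B. insert y (B - {x}) \<in> indeps M}"
  have D: "D \<in> indeps M" using indB by (rule indep_subset) (auto simp: D_def)
  have dep: "insert y D \<notin> indeps M"
  proof
    assume yD: "insert y D \<in> indeps M"
    let ?R = "restriction M (insert y B)"
    from yD have "insert y D \<in> indeps ?R" by (auto simp: D_def)
    then obtain K where K: "K \<in> bases ?R" "insert y D \<subseteq> K"
      using indep_extends_to_base by blast
    have "B \<in> bases ?R" using B by (auto simp: bases_def)
    with K have cardK: "card K = card B" using card_bases by blast
    have KB: "K \<subseteq> insert y B" and indK: "K \<in> indeps M" using base_indep [OF K(1)] by auto
    have "\<not> B \<subseteq> K"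
    proof
      assume "B \<subseteq> K"
      then have "insert y B \<subseteq> K" using K by blast
      then have "card (insert y B) \<le> card K" by (meson card_mono finite_indep indK)
      then show False using cardK y finB by simp
    qed
    then obtain x where x: "x \<in> B" "x \<notin> K" by blast
    have "insert y (B - {x}) = K"
    proof (rule card_subset_eq [symmetric])
      show "K \<subseteq> insert y (B - {x})" using KB x by blast
      show "card K = card (insert y (B - {x}))"
        using cardK card_exchange [OF finB x(1)] y by simp
    qed (use finB in simp)
    with indK x have "x \<in> D" by (simp add: D_def)
    with K x show False by blast
  qed
  have "\<exists>x\<in>D. x \<notin> B' \<and> insert x (B' - {y}) \<in> indeps M"
  proof (rule ccontr)
    assume neg: "\<not> ?thesis"
    let ?R = "restriction M ((B' - {y}) \<union> D)"
    have "B' - {y} \<in> bases ?R"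
      unfolding bases_def
    proof (intro CollectI conjI ballI impI)
      show "B' - {y} \<in> indeps ?R" using indep_subset [OF indB', of "B' - {y}"] by auto
      fix Z assume Z: "Z \<in> indeps ?R" "B' - {y} \<subseteq> Z"
      have "x \<in> B' - {y}" if "x \<in> Z" for x
      proof (rule ccontr)
        assume "x \<notin> B' - {y}"
        with that Z have x: "x \<in> D" by auto
        then have "x \<noteq> y" using y by (auto simp: D_def)
        with \<open>x \<notin> B' - {y}\<close> have "x \<notin> B'" by blast
        moreover have "insert x (B' - {y}) \<in> indeps M"
          using Z that indep_subset [of Z M "insert x (B' - {y})"] by auto
        ultimately show False using neg x by blast
      qed
      with Z(2) show "Z = B' - {y}" by blast
    qed
    moreover obtain J where J: "J \<in> bases ?R" "D \<subseteq> J"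
      using indep_extends_to_base [of D ?R] D by auto
    ultimately have "card J = card (B' - {y})" using card_bases by blast
    then have "card J < card B'" using y finB' by (metis DiffD1 card_Diff1_less)
    moreover have "J \<in> indeps M" using base_indep [OF J(1)] by simp
    ultimately obtain z where z: "z \<in> B' - J" "insert z J \<in> indeps M"
      using indep_augment indB' by blast
    have "z = y"
    proof (rule ccontr)
      assume "z \<noteq> y"
      with z have "insert z J \<in> indeps ?R" using base_indep [OF J(1)] by auto
      with J(1) have "insert z J = J" unfolding bases_def by blast
      with z show False by blast
    qed
    with z J(2) have "insert y D \<in> indeps M" by (auto intro: indep_subset)
    with dep show False by blast
  qed
  then obtain x where x: "x \<in> B" "insert y (B - {x}) \<in> indeps M" "x \<notin> B'"
    "insert x (B' - {y}) \<in> indeps M" by (auto simp: D_def)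
  have "card (insert y (B - {x})) = card B"
    using card_exchange [OF finB x(1)] y by simp
  with x(2) B have "insert y (B - {x}) \<in> bases M" by (blast intro: baseI)
  moreover have "card (insert x (B' - {y})) = card B'"
    using card_exchange [OF finB'] x y by simp
  with x(4) B' have "insert x (B' - {y}) \<in> bases M" by (blast intro: baseI)
  ultimately show ?thesis using x by blast
qed

lemma weight_exchange:
  assumes "finite B" "x \<in> B" "y \<notin> B"
  shows "weight f (insert y (B - {x})) + nat_of_num (f x) = weight f B + nat_of_num (f y)"
  using assms by (simp add: weight_def sum.remove [of B x])

lemma generic_iff_exchange:
  "generic M f \<longleftrightarrow>
    (\<exists>B\<in>bases M. \<forall>x\<in>B. \<forall>y. y \<notin> B \<longrightarrow> insert y (B - {x}) \<in> bases M \<longrightarrow> f x < f y)"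
  (is "_ \<longleftrightarrow> ?R")
proof
  assume "generic M f"
  then obtain B where B: "B \<in> bases M" "\<And>B'. B' \<in> bases M \<Longrightarrow> weight f B \<le> weight f B'"
    and uniq: "\<And>C. C \<in> bases M \<Longrightarrow> (\<And>B'. B' \<in> bases M \<Longrightarrow> weight f C \<le> weight f B') \<Longrightarrow> C = B"
    unfolding generic_def by metis
  have "f x < f y" if x: "x \<in> B" and y: "y \<notin> B" "insert y (B - {x}) \<in> bases M" for x y
  proof -
    let ?C = "insert y (B - {x})"
    have "weight f B < weight f ?C"
    proof (rule ccontr)
      assume "\<not> ?thesis"
      then have "?C = B" using uniq [of ?C] B(2) y(2) by (meson le_trans linorder_not_less)
      with y show False by blast
    qed
    moreover have "finite B" using B(1) base_indep finite_indep by blast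
    ultimately show ?thesis
      using weight_exchange [of B x y f] x y(1) by (simp add: less_num_def)
  qed
  with B(1) show ?R by blast
next
  assume ?R
  then obtain B where B: "B \<in> bases M"
    and ex: "\<And>x y. x \<in> B \<Longrightarrow> y \<notin> B \<Longrightarrow> insert y (B - {x}) \<in> bases M \<Longrightarrow> f x < f y"
    by blast
  have lt: "weight f B < weight f B'" if "B' \<in> bases M" "B' \<noteq> B" for B'
    using that
  proof (induction "weight f B'" arbitrary: B' rule: less_induct)
    case less
    have finB: "finite B" and finB': "finite B'"
      using B less.prems base_indep finite_indep by blast+
    have "\<not> B' \<subseteq> B"
      using less.prems B card_bases [of B M B'] card_subset_eq [OF finB] by metis
    then obtain y where y: "y \<in> B' - B" by blast
    from base_symmetric_exchange [OF B less.prems(1) y] obtain x where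
      x: "x \<in> B - B'" "insert y (B - {x}) \<in> bases M" "insert x (B' - {y}) \<in> bases M" by blast
    then have "f x < f y" using ex y by blast
    then have "nat_of_num (f x) < nat_of_num (f y)" by (simp add: less_num_def)
    with weight_exchange [of B' y x f] x y finB' 
    have *: "weight f (insert x (B' - {y})) < weight f B'" by simp
    show ?case
    proof (cases "insert x (B' - {y}) = B")
      case True
      with * show ?thesis by simp
    next
      case False
      with less.hyps [OF * x(3)] * show ?thesis by simp
    qed
  qed
  show "generic M f"
    unfolding generic_def
  proof (rule ex1I [of _ B])
    show "B \<in> bases M \<and> (\<forall>B'\<in>bases M. weight f B \<le> weight f B')"
      using B lt by (metis le_eq_less_or_eq)
    fix C assume C: "C \<in> bases M \<and> (\<forall>B'\<in>bases M. weight f C \<le> weight f B')"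
    then show "C = B" using lt [of C] B by (metis linorder_not_less)
  qed
qed

lemma base_subset_ground: "B \<in> bases M \<Longrightarrow> B \<subseteq> ground M"
  by (simp add: base_indep indeps_subset_ground)

lemma generic_cong:
  assumes "\<And>x y. x \<in> ground M \<Longrightarrow> y \<in> ground M \<Longrightarrow> f x < f y \<Longrightarrow> g x < g y"
    and "generic M f"
  shows "generic M g"
proof -
  from assms(2) obtain B where B: "B \<in> bases M"
    "\<And>x y. x \<in> B \<Longrightarrow> y \<notin> B \<Longrightarrow> insert y (B - {x}) \<in> bases M \<Longrightarrow> f x < f y"
    unfolding generic_iff_exchange by blast
  have "g x < g y" if "x \<in> B" "y \<notin> B" "insert y (B - {x}) \<in> bases M" for x y
    using assms(1) [of x y] B(2) [OF that] that base_subset_ground B(1) by blast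
  with B(1) show ?thesis unfolding generic_iff_exchange by blast
qed

lemma lookup_sum_single:
  "finite E \<Longrightarrow> Poly_Mapping.lookup (\<Sum>e\<in>E. Poly_Mapping.single (f e) (1::nat)) v = card {e \<in> E. f e = v}"
  by (simp add: lookup_sum lookup_single when_def flip: sum.inter_filter)

lemma mdegree_sum_single:
  "mdegree (\<Sum>e\<in>E. Poly_Mapping.single (f e) (1::nat)) = card E"
  by (induction E rule: infinite_finite_induct) (simp_all add: mdegree_add)

lemma finite_monom_colorings:
  "finite {f \<in> ground M \<rightarrow>\<^sub>E UNIV. generic M f \<and>
    (\<Sum>e\<in>ground M. Poly_Mapping.single (f e) (1::nat)) = m}" (is "finite ?S")
proof (rule finite_subset)
  show "?S \<subseteq> ground M \<rightarrow>\<^sub>E Poly_Mapping.keys m"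
  proof clarify
    fix f assume f: "f \<in> ground M \<rightarrow>\<^sub>E UNIV"
    show "f \<in> ground M \<rightarrow>\<^sub>E Poly_Mapping.keys (\<Sum>e\<in>ground M. Poly_Mapping.single (f e) (1::nat))"
      using f unfolding PiE_iff in_keys_iff lookup_sum_single [OF finite_ground]
      by (auto simp: card_eq_0_iff)
  qed
qed (simp add: finite_PiE)

lemma quasisymmetric_F_series: "quasisymmetric (F_series M)"
proof -
  let ?mon = "\<lambda>f. \<Sum>e\<in>ground M. Poly_Mapping.single (f e) (1::nat) :: num monomial"
  let ?S = "\<lambda>m. {f \<in> ground M \<rightarrow>\<^sub>E UNIV. generic M f \<and> ?mon f = m}"
  have "mdegree m \<le> card (ground M)" if "coeff (F_series M) m \<noteq> 0" for m
  proof -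
    have "?S m \<noteq> {}"
      using that unfolding F_series.rep_eq by (metis (no_types, lifting) card.empty of_nat_0)
    then obtain f where "?mon f = m" by blast
    then show ?thesis using mdegree_sum_single [of f "ground M"] by simp
  qed
  moreover have le: "card (?S (monom_of vs \<alpha>)) \<le> card (?S (monom_of ws \<alpha>))"
    if vs: "length vs = length \<alpha>" "sorted_wrt (<) vs"
      and ws: "length ws = length \<alpha>" "sorted_wrt (<) ws" for vs ws \<alpha>
  proof -
    define \<sigma> where "\<sigma> v = the (map_of (zip vs ws) v)" for v
    have dvs: "distinct vs" and dws: "distinct ws"
      using vs ws by (simp_all add: sorted_wrt_less_distinct)
    have \<sigma>: "\<sigma> (vs ! i) = ws ! i" if "i < length \<alpha>" for i
      using that vs ws dvs by (simp add: \<sigma>_def map_of_zip_nth)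
    have mono: "\<sigma> v < \<sigma> w" if "v \<in> set vs" "w \<in> set vs" "v < w" for v w
    proof -
      from that obtain i j where ij: "v = vs ! i" "w = vs ! j" "i < length vs" "j < length vs"
        by (metis in_set_conv_nth)
      have "i < j"
        using ij \<open>v < w\<close> vs(2) by (metis linorder_neqE_nat not_less_iff_gr_or_eq sorted_wrt_nth_less)
      then show ?thesis
        using ij ws vs(1) by (simp add: \<sigma> sorted_wrt_nth_less)
    qed
    have inj: "inj_on \<sigma> (set vs)"
      using mono by (metis inj_onI less_irrefl linorder_neqE)
    have range: "f e \<in> set vs" if "f \<in> ?S (monom_of vs \<alpha>)" "e \<in> ground M" for f e
    proof -
      have "Poly_Mapping.lookup (?mon f) (f e) \<noteq> 0"
        using that(2) unfolding lookup_sum_single [OF finite_ground] by (auto simp: card_eq_0_iff)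
      with that(1) have "f e \<in> Poly_Mapping.keys (monom_of vs \<alpha>)" by (simp add: in_keys_iff)
      then show ?thesis by (rule subsetD [OF keys_monom_of])
    qed
    let ?\<phi> = "\<lambda>f. restrict (\<lambda>e. \<sigma> (f e)) (ground M)"
    have "inj_on ?\<phi> (?S (monom_of vs \<alpha>))"
    proof (rule inj_onI)
      fix f g assume f: "f \<in> ?S (monom_of vs \<alpha>)" and g: "g \<in> ?S (monom_of vs \<alpha>)" and eq: "?\<phi> f = ?\<phi> g"
      have "f e = g e" if e: "e \<in> ground M" for e
        using fun_cong [OF eq, of e] range [OF f e] range [OF g e] inj e by (auto dest: inj_onD)
      moreover have "f \<in> extensional (ground M)" "g \<in> extensional (ground M)"
        using f g by (auto simp: PiE_iff)
      ultimately show "f = g" by (rule extensionalityI [rotated 2])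
    qed
    moreover have "?\<phi> ` ?S (monom_of vs \<alpha>) \<subseteq> ?S (monom_of ws \<alpha>)"
    proof (intro image_subsetI CollectI conjI)
      fix f assume f: "f \<in> ?S (monom_of vs \<alpha>)"
      show "?\<phi> f \<in> ground M \<rightarrow>\<^sub>E UNIV" by simp
      show "generic M (?\<phi> f)"
      proof (rule generic_cong)
        show "generic M f" using f by simp
        show "?\<phi> f x < ?\<phi> f y" if "x \<in> ground M" "y \<in> ground M" "f x < f y" for x y
          using that range [OF f] mono by simp
      qed
      show "?mon (?\<phi> f) = monom_of ws \<alpha>"
      proof (rule poly_mapping_eqI)
        fix w
        have L: "Poly_Mapping.lookup (?mon (?\<phi> f)) w = card {e \<in> ground M. \<sigma> (f e) = w}"
          unfolding lookup_sum_single [OF finite_ground] by (simp cong: conj_cong)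
        show "Poly_Mapping.lookup (?mon (?\<phi> f)) w = Poly_Mapping.lookup (monom_of ws \<alpha>) w"
        proof (cases "w \<in> set ws")
          case True
          then obtain i where i: "i < length \<alpha>" "w = ws ! i" using ws(1) by (metis in_set_conv_nth)
          have "{e \<in> ground M. \<sigma> (f e) = w} = {e \<in> ground M. f e = vs ! i}"
            using i range [OF f] inj vs(1) by (auto simp: \<sigma> dest!: inj_onD simp flip: \<sigma>)
          then have "Poly_Mapping.lookup (?mon (?\<phi> f)) w = Poly_Mapping.lookup (?mon f) (vs ! i)"
            using L by (simp only: lookup_sum_single [OF finite_ground])
          also have "\<dots> = Poly_Mapping.lookup (monom_of vs \<alpha>) (vs ! i)" using f by simp
          also have "\<dots> = map (Poly_Mapping.lookup (monom_of vs \<alpha>)) vs ! i"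
            using i vs(1) by simp
          also have "\<dots> = map (Poly_Mapping.lookup (monom_of ws \<alpha>)) ws ! i"
            using vs ws dvs dws by (simp add: map_lookup_monom_of)
          also have "\<dots> = Poly_Mapping.lookup (monom_of ws \<alpha>) w"
            using i ws(1) by simp
          finally show ?thesis .
        next
          case False
          have "\<sigma> (f e) \<in> set ws" if "e \<in> ground M" for e
            using range [OF f that] \<sigma> vs(1) ws(1) by (metis in_set_conv_nth nth_mem)
          then have "{e \<in> ground M. \<sigma> (f e) = w} = {}" using False by blast
          then show ?thesis using L lookup_monom_of_notin [OF False, of \<alpha>] by (simp only: card.empty)
        qed
      qed
    qed
    ultimately show ?thesis by (rule card_inj_on_le) (rule finite_monom_colorings)
  qed
  ultimately show ?thesis
    unfolding quasisymmetric_def F_series.rep_eq of_nat_eq_iff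
    by (blast intro: le_antisym)
qed

lemma F_series_cong:
  assumes "M \<cong>\<^sub>M N"
  shows "F_series M = F_series N"
proof -
  have le: "coeff (F_series N) m \<le> coeff (F_series M) m" if h: "matroid_iso h M N"
    for h m and M :: "'x matroid" and N :: "'y matroid"
  proof -
    let ?S = "{f \<in> ground M \<rightarrow>\<^sub>E UNIV. generic M f \<and> (\<Sum>e\<in>ground M. Poly_Mapping.single (f e) 1) = m}"
    let ?T = "{f \<in> ground N \<rightarrow>\<^sub>E UNIV. generic N f \<and> (\<Sum>e\<in>ground N. Poly_Mapping.single (f e) 1) = m}"
    let ?\<phi> = "\<lambda>f. restrict (\<lambda>e. f (h e)) (ground M)"
    have b: "bij_betw h (ground M) (ground N)" using h by (simp add: matroid_iso_def)
    then have inj: "inj_on h (ground M)" and surj: "h ` ground M = ground N"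
      by (auto simp: bij_betw_def)
    have "inj_on ?\<phi> ?T"
    proof (rule inj_onI)
      fix f g assume f: "f \<in> ?T" and g: "g \<in> ?T" and eq: "?\<phi> f = ?\<phi> g"
      have "f e = g e" if e: "e \<in> ground N" for e
      proof -
        from e surj obtain d where "d \<in> ground M" "e = h d" by blast
        with fun_cong [OF eq, of d] show ?thesis by simp
      qed
      moreover have "f \<in> extensional (ground N)" "g \<in> extensional (ground N)"
        using f g by (auto simp: PiE_iff)
      ultimately show "f = g" by (rule extensionalityI [rotated 2])
    qed
    moreover have "?\<phi> ` ?T \<subseteq> ?S"
    proof (intro image_subsetI CollectI conjI)
      fix f assume f: "f \<in> ?T"
      show "?\<phi> f \<in> ground M \<rightarrow>\<^sub>E UNIV" by simp
      have w: "weight (?\<phi> f) B = weight f (h ` B)" if "B \<subseteq> ground M" for B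
        using that inj by (auto simp: weight_def sum.reindex inj_on_subset intro!: sum.cong)
      from f have "generic N f" by blast
      then obtain C where C: "C \<in> bases N" "\<And>B'. B' \<in> bases N \<Longrightarrow> weight f C \<le> weight f B'"
        and uniq: "\<And>D. D \<in> bases N \<Longrightarrow> (\<And>B'. B' \<in> bases N \<Longrightarrow> weight f D \<le> weight f B') \<Longrightarrow> D = C"
        unfolding generic_def by metis
      obtain B where B: "B \<subseteq> ground M" "C = h ` B"
        using base_subset_ground [OF C(1)] surj by (metis subset_imageE)
      have ib: "h ` X \<in> bases N" if "X \<in> bases M" for X
        using matroid_iso_bases [OF h base_subset_ground [OF that]] that by simp
      show "generic M (?\<phi> f)"
        unfolding generic_def
      proof (rule ex1I [of _ B])
        show "B \<in> bases M \<and> (\<forall>B'\<in>bases M. weight (?\<phi> f) B \<le> weight (?\<phi> f) B')"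
          using B C ib matroid_iso_bases [OF h B(1)] by (simp add: w base_subset_ground)
        fix D assume D: "D \<in> bases M \<and> (\<forall>B'\<in>bases M. weight (?\<phi> f) D \<le> weight (?\<phi> f) B')"
        then have "D \<subseteq> ground M" by (simp add: base_subset_ground)
        have "h ` D = C"
        proof (rule uniq)
          show "h ` D \<in> bases N" using D ib by blast
          fix B' assume B': "B' \<in> bases N"
          then obtain X where X: "X \<subseteq> ground M" "B' = h ` X"
            using base_subset_ground surj by (metis subset_imageE)
          with B' have "X \<in> bases M" using matroid_iso_bases [OF h] by simp
          with D have "weight (?\<phi> f) D \<le> weight (?\<phi> f) X" by blast
          then show "weight f (h ` D) \<le> weight f B'"
            using w [OF X(1)] w [OF \<open>D \<subseteq> ground M\<close>] X(2) by simp
        qed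
        with B \<open>D \<subseteq> ground M\<close> show "D = B" using inj by (simp add: inj_on_image_eq_iff)
      qed
      have "(\<Sum>e\<in>ground M. Poly_Mapping.single (?\<phi> f e) (1::nat))
          = (\<Sum>e\<in>ground M. Poly_Mapping.single (f (h e)) 1)"
        by (intro sum.cong) auto
      also have "\<dots> = (\<Sum>e\<in>ground N. Poly_Mapping.single (f e) 1)"
        by (rule sum.reindex_bij_betw [OF b])
      finally show "(\<Sum>e\<in>ground M. Poly_Mapping.single (?\<phi> f e) 1) = m" using f by simp
    qed
    ultimately have "card ?T \<le> card ?S"
      by (rule card_inj_on_le) (rule finite_monom_colorings)
    then show ?thesis by (simp add: F_series.rep_eq)
  qed
  from assms obtain h where h: "matroid_iso h M N" by (auto simp: isomorphic_def)
  show ?thesis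
    by (rule power_series_eqI, rule order.antisym) (rule le [OF matroid_iso_inv [OF h]], rule le [OF h])
qed

definition matroid_F :: "'a matroid \<Rightarrow> qsym"
  where "matroid_F M = Abs_qsym (F_series M)"

lemma series_of_matroid_F: "series_of_qsym (matroid_F M) = F_series M"
  by (simp add: matroid_F_def Abs_qsym_inverse quasisymmetric_F_series)

lift_definition class_F :: "matroid_class \<Rightarrow> qsym" is matroid_F
  by (simp add: matroid_F_def F_series_cong)

lemma class_F_mclass: "class_F (mclass M) = matroid_F M"
  unfolding mclass_def class_F.abs_eq matroid_F_def
  by (simp add: F_series_cong [OF isomorphic_nat_copy [of M]])

definition F_map :: "mat \<Rightarrow> qsym"
  where "F_map = free_extend class_F"

lemma F_map_mclass: "F_map (frag_of (mclass M)) = matroid_F M"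
  by (simp add: F_map_def class_F_mclass)

end

theory Submission
  imports Defs
begin

text \<open>If \<open>f\<close> takes smaller values on \<open>A\<close> than outside \<open>A\<close>, then a base of minimal weight meets \<open>A\<close> in a
  base of \<open>M|A\<close> and its remainder is a base of \<open>M/A\<close>; hence \<open>f\<close> is \<open>M\<close>-generic iff its two parts are
  generic for \<open>M|A\<close> and \<open>M/A\<close>. Colorings of \<open>E\<close> by \<open>x\<^sub>1 < x\<^sub>2 < \<dots> < y\<^sub>1 < y\<^sub>2 < \<dots>\<close> are sorted by the set \<open>A\<close>
  of elements with an \<open>x\<close>-color, which gives the coproduct formula. Multiplicativity holds because a minimal
  base of a direct sum is a sum of minimal bases. Compatibility with antipodes follows from the uniqueness of left
  convolution inverses.\<close>

section \<open>Bases of minors and direct sums\<close>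

lemma base_maximal: "B \<in> bases M \<Longrightarrow> X \<in> indeps M \<Longrightarrow> B \<subseteq> X \<Longrightarrow> X = B"
  by (simp add: bases_def)

lemma maximal_indep_base:
  "(\<And>X. X \<in> indeps M \<Longrightarrow> B \<subseteq> X \<Longrightarrow> X = B) \<Longrightarrow> B \<in> indeps M \<Longrightarrow> B \<in> bases M"
  by (simp add: bases_def)

text \<open>\<open>Z \<inter> A\<close> is independent in \<open>M|A\<close> and contains the
  maximal set \<open>J\<close>. An independent extension of \<open>J\<close> therefore adds elements
  outside \<open>A\<close> only.\<close>

lemma base_restriction_maximal:
  assumes "J \<in> bases (restriction M A)" "Z \<in> indeps M" "J \<subseteq> Z"
  shows "Z \<inter> A = J"
proof -
  have "Z \<inter> A \<in> indeps (restriction M A)"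
    using assms(2) by (auto intro: indep_subset)
  moreover have "J \<subseteq> Z \<inter> A"
    using base_indep [OF assms(1)] assms(3) by auto
  ultimately show ?thesis by (rule base_maximal [OF assms(1)])
qed

text \<open>The definition of contraction asks for some base of \<open>M|A\<close>; here any
  prescribed base \<open>J\<close> serves. An extension \<open>K\<close> of \<open>J\<close> inside
  \<open>X \<union> J \<union> J'\<close> gains nothing in \<open>A\<close>, so it lies in
  \<open>X \<union> J\<close>, and cardinality forces equality.\<close>

lemma indep_contraction_iff:
  assumes J: "J \<in> bases (restriction M A)"
  shows "X \<in> indeps (contraction M A) \<longleftrightarrow> X \<inter> A = {} \<and> X \<union> J \<in> indeps M"
proof
  assume "X \<inter> A = {} \<and> X \<union> J \<in> indeps M"
  then show "X \<in> indeps (contraction M A)"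
    using J indeps_subset_ground [of "X \<union> J" M] unfolding indeps_contraction by blast
next
  assume "X \<in> indeps (contraction M A)"
  then obtain J' where X: "X \<subseteq> ground M - A"
    and J': "J' \<in> bases (restriction M A)" "X \<union> J' \<in> indeps M"
    unfolding indeps_contraction by blast
  have JA: "J \<subseteq> A" "J \<in> indeps M" and JA': "J' \<subseteq> A" "J' \<in> indeps M"
    using base_indep [OF J] base_indep [OF J'(1)] by auto
  let ?R = "restriction M (X \<union> J \<union> J')"
  obtain K where K: "K \<in> bases ?R" "J \<subseteq> K"
    using indep_extends_to_base [of J ?R] JA by auto
  have KM: "K \<in> indeps M" "K \<subseteq> X \<union> J \<union> J'" using base_indep [OF K(1)] by auto
  have "K \<inter> A = J" using base_restriction_maximal [OF J KM(1) K(2)] .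
  then have sub: "K \<subseteq> X \<union> J" using KM JA' by blast
  have fin: "finite X" "finite J" "finite J'"
    using X JA JA' by (auto intro: finite_indep finite_subset [OF _ finite_ground])
  have "card (X \<union> J) = card X + card J" "card (X \<union> J') = card X + card J'"
    using X JA JA' fin by (auto intro!: card_Un_disjoint)
  \<comment> \<open>\<open>X \<union> J'\<close> is independent in \<open>?R\<close>, of which
    \<open>K\<close> is a base.\<close>
  moreover have "card (X \<union> J') \<le> card K"
    using J'(2) K(1) by (auto intro!: card_indep_le_base [of _ ?R])
  ultimately have "card (X \<union> J) \<le> card K" using card_bases [OF J J'(1)] by simp
  with sub fin have "K = X \<union> J" by (intro card_seteq) auto
  with KM X show "X \<inter> A = {} \<and> X \<union> J \<in> indeps M" by auto
qed

text \<open>Since \<open>J\<close> is arbitrary, the part of a base in \<open>A\<close> can be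
  replaced by any other base of \<open>M|A\<close> without disturbing the part outside
  \<open>A\<close>. The proof transfers maximality by splitting a larger independent set
  \<open>Z\<close> into \<open>Z - A\<close> and \<open>J\<close>.\<close>

lemma base_contraction_iff:
  assumes J: "J \<in> bases (restriction M A)"
  shows "X \<in> bases (contraction M A) \<longleftrightarrow> X \<inter> A = {} \<and> X \<union> J \<in> bases M"
proof -
  have JA: "J \<subseteq> A" using base_indep [OF J] by auto
  show ?thesis
  proof
    assume X: "X \<in> bases (contraction M A)"
    then have XA: "X \<inter> A = {}" and XJ: "X \<union> J \<in> indeps M"
      using indep_contraction_iff [OF J] base_indep by blast+
    have "Z = X \<union> J" if Z: "Z \<in> indeps M" "X \<union> J \<subseteq> Z" for Z
    proof -
      have ZA: "Z \<inter> A = J" using base_restriction_maximal [OF J Z(1)] Z(2) by blast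
      then have "(Z - A) \<union> J = Z" by blast
      then have "Z - A \<in> indeps (contraction M A)"
        using Z(1) indep_contraction_iff [OF J] by auto
      moreover have "X \<subseteq> Z - A" using Z(2) XA by blast
      ultimately have "Z - A = X" by (rule base_maximal [OF X])
      with ZA show ?thesis by blast
    qed
    then have "X \<union> J \<in> bases M" using XJ by (rule maximal_indep_base)
    with XA show "X \<inter> A = {} \<and> X \<union> J \<in> bases M" ..
  next
    assume X: "X \<inter> A = {} \<and> X \<union> J \<in> bases M"
    then have XC: "X \<in> indeps (contraction M A)" using indep_contraction_iff [OF J] base_indep by blast
    have "Y = X" if Y: "Y \<in> indeps (contraction M A)" "X \<subseteq> Y" for Y
    proof -
      have "Y \<inter> A = {}" "Y \<union> J \<in> indeps M" using Y indep_contraction_iff [OF J] by blast+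
      moreover from this have "Y \<union> J = X \<union> J"
        using X Y(2) by (intro base_maximal [of "X \<union> J" M]) auto
      ultimately show ?thesis using X JA by blast
    qed
    then show "X \<in> bases (contraction M A)" using XC by (rule maximal_indep_base)
  qed
qed

text \<open>Preimages are used because every set in a sum type is the sum of its two preimages.
  Enlarging one component alone shows that each is maximal.\<close>

lemma base_direct_sum_iff:
  "Z \<in> bases (direct_sum M N) \<longleftrightarrow> Inl -` Z \<in> bases M \<and> Inr -` Z \<in> bases N"
proof
  assume Z: "Z \<in> bases (direct_sum M N)"
  then have ind: "Inl -` Z \<in> indeps M" "Inr -` Z \<in> indeps N"
    using base_indep mem_indeps_direct_sum by blast+
  have L: "X = Inl -` Z" if "X \<in> indeps M" "Inl -` Z \<subseteq> X" for X
  proof -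
    have "X <+> Inr -` Z \<in> indeps (direct_sum M N)"
      using that ind unfolding indeps_direct_sum by blast
    moreover have "Z \<subseteq> X <+> Inr -` Z"
    proof
      show "s \<in> X <+> Inr -` Z" if "s \<in> Z" for s
        using that \<open>Inl -` Z \<subseteq> X\<close> by (cases s) auto
    qed
    ultimately have "X <+> Inr -` Z = Z" by (rule base_maximal [OF Z])
    then show ?thesis by blast
  qed
  have R: "Y = Inr -` Z" if "Y \<in> indeps N" "Inr -` Z \<subseteq> Y" for Y
  proof -
    have "Inl -` Z <+> Y \<in> indeps (direct_sum M N)"
      using that ind unfolding indeps_direct_sum by blast
    moreover have "Z \<subseteq> Inl -` Z <+> Y"
    proof
      show "s \<in> Inl -` Z <+> Y" if "s \<in> Z" for s
        using that \<open>Inr -` Z \<subseteq> Y\<close> by (cases s) auto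
    qed
    ultimately have "Inl -` Z <+> Y = Z" by (rule base_maximal [OF Z])
    then show ?thesis by blast
  qed
  show "Inl -` Z \<in> bases M \<and> Inr -` Z \<in> bases N"
    using maximal_indep_base [OF L ind(1)] maximal_indep_base [OF R ind(2)] ..
next
  assume Z: "Inl -` Z \<in> bases M \<and> Inr -` Z \<in> bases N"
  have "W = Z" if "W \<in> indeps (direct_sum M N)" "Z \<subseteq> W" for W
  proof -
    have "Inl -` W = Inl -` Z"
      by (rule base_maximal) (use that Z in \<open>auto simp: mem_indeps_direct_sum\<close>)
    moreover have "Inr -` W = Inr -` Z"
      by (rule base_maximal) (use that Z in \<open>auto simp: mem_indeps_direct_sum\<close>)
    ultimately show ?thesis by (metis Plus_vimage)
  qed
  then show "Z \<in> bases (direct_sum M N)"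
    by (rule maximal_indep_base) (use Z in \<open>simp_all add: mem_indeps_direct_sum base_indep\<close>)
qed

section \<open>Generic colorings\<close>

text \<open>Both directions go through \<open>generic_iff_exchange\<close>, so only single exchanges
  have to be compared.\<close>

lemma generic_split:
  assumes low: "\<And>x y. x \<in> ground M \<inter> A \<Longrightarrow> y \<in> ground M - A \<Longrightarrow> f x < f y"
  shows "generic M f \<longleftrightarrow> generic (restriction M A) f \<and> generic (contraction M A) f"
proof
  assume "generic M f"
  then obtain B where B: "B \<in> bases M"
    and ex: "\<And>x y. x \<in> B \<Longrightarrow> y \<notin> B \<Longrightarrow> insert y (B - {x}) \<in> bases M \<Longrightarrow> f x < f y"
    unfolding generic_iff_exchange by blast
  have BE: "B \<subseteq> ground M" and finB: "finite B"
    using B base_subset_ground base_indep finite_indep by blast+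
  \<comment> \<open>If some \<open>y\<close> in \<open>A\<close> could be added to
    \<open>B \<inter> A\<close>, it could be exchanged for some \<open>x\<close> of \<open>B\<close>
    outside \<open>A\<close>; the choice of \<open>B\<close> then gives \<open>f x < f y\<close>,
    contrary to \<open>low\<close>.\<close>
  have BA: "B \<inter> A \<in> bases (restriction M A)"
    unfolding bases_def
  proof (intro CollectI conjI ballI impI)
    show "B \<inter> A \<in> indeps (restriction M A)"
      using base_indep [OF B] by (auto intro: indep_subset)
    fix Z assume Z: "Z \<in> indeps (restriction M A)" "B \<inter> A \<subseteq> Z"
    show "Z = B \<inter> A"
    proof (rule ccontr)
      assume "Z \<noteq> B \<inter> A"
      with Z obtain y where y: "y \<in> Z" "y \<in> A" "y \<notin> B" by auto
      have "insert y (B \<inter> A) \<in> indeps M" using Z y by (auto intro: indep_subset)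
      \<comment> \<open>Extending within \<open>insert y B\<close> produces a base \<open>K\<close>
        that differs from \<open>B\<close> by one exchange.\<close>
      then have "insert y (B \<inter> A) \<in> indeps (restriction M (insert y B))" by auto
      then obtain K where K: "K \<in> bases (restriction M (insert y B))" "insert y (B \<inter> A) \<subseteq> K"
        using indep_extends_to_base by blast
      have KM: "K \<in> indeps M" "K \<subseteq> insert y B" using base_indep [OF K(1)] by auto
      have "B \<in> bases (restriction M (insert y B))" using B by (auto simp: bases_def)
      then have cardK: "card K = card B" using K(1) card_bases by blast
      then have KB: "K \<in> bases M" using baseI [OF KM(1) B] by blast
      have "\<not> B \<subseteq> K"
        using y K(2) base_maximal [OF B KM(1)] by blast
      then obtain x where x: "x \<in> B" "x \<notin> K" by blast
      have "K = insert y (B - {x})"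
        using KM x cardK card_exchange [OF finB x(1) y(3)] finB by (intro card_subset_eq) auto
      with KB have "f x < f y" using ex x y by blast
      moreover have "f y < f x"
        using low [of y x] x y K(2) BE indeps_subset_ground [OF KM(1)] by blast
      ultimately show False by simp
    qed
  qed
  note iff = base_contraction_iff [OF BA]
  have dec: "B - A \<union> B \<inter> A = B" by blast
  have BC: "B - A \<in> bases (contraction M A)" using iff [of "B - A"] B dec by auto
  have "generic (restriction M A) f"
    unfolding generic_iff_exchange
  proof (intro bexI [OF _ BA] ballI allI impI)
    fix x y assume xy: "x \<in> B \<inter> A" "y \<notin> B \<inter> A" "insert y (B \<inter> A - {x}) \<in> bases (restriction M A)"
    then have y: "y \<in> A" "y \<notin> B" using base_indep by fastforce+
    \<comment> \<open>The base \<open>B - A\<close> of the contraction combines with the exchanged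
      base of \<open>M|A\<close> as well.\<close>
    have "B - A \<union> insert y (B \<inter> A - {x}) \<in> bases M"
      using base_contraction_iff [OF xy(3), of "B - A"] BC by blast
    moreover have "B - A \<union> insert y (B \<inter> A - {x}) = insert y (B - {x})" using xy by blast
    ultimately show "f x < f y" using ex xy y by auto
  qed
  moreover have "generic (contraction M A) f"
    unfolding generic_iff_exchange
  proof (intro bexI [OF _ BC] ballI allI impI)
    fix x y assume xy: "x \<in> B - A" "y \<notin> B - A" "insert y (B - A - {x}) \<in> bases (contraction M A)"
    then have "y \<notin> A" "insert y (B - A - {x}) \<union> B \<inter> A \<in> bases M"
      using iff [of "insert y (B - A - {x})"] by simp_all
    moreover have "insert y (B - A - {x}) \<union> B \<inter> A = insert y (B - {x})" using xy by blast
    ultimately show "f x < f y" using ex xy by auto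
  qed
  ultimately show "generic (restriction M A) f \<and> generic (contraction M A) f" ..
next
  assume gen: "generic (restriction M A) f \<and> generic (contraction M A) f"
  then obtain J where J: "J \<in> bases (restriction M A)"
    and exJ: "\<And>x y. x \<in> J \<Longrightarrow> y \<notin> J \<Longrightarrow> insert y (J - {x}) \<in> bases (restriction M A) \<Longrightarrow> f x < f y"
    unfolding generic_iff_exchange by blast
  from gen obtain C where C: "C \<in> bases (contraction M A)"
    and exC: "\<And>x y. x \<in> C \<Longrightarrow> y \<notin> C \<Longrightarrow> insert y (C - {x}) \<in> bases (contraction M A) \<Longrightarrow> f x < f y"
    unfolding generic_iff_exchange by blast
  have CA: "C \<inter> A = {}" and CJ: "C \<union> J \<in> bases M" using C base_contraction_iff [OF J] by blast+
  have JA: "J \<subseteq> A" "finite J" using base_indep [OF J] finite_indep by auto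
  show "generic M f"
    unfolding generic_iff_exchange
  proof (intro bexI [OF _ CJ] ballI allI impI)
    fix x y assume x: "x \<in> C \<union> J" and y: "y \<notin> C \<union> J"
      and B: "insert y (C \<union> J - {x}) \<in> bases M"
    note BM = base_indep [OF B]
    have E: "x \<in> ground M" "y \<in> ground M"
      using x base_subset_ground [OF CJ] base_subset_ground [OF B] by auto
    show "f x < f y"
    \<comment> \<open>For \<open>x\<close> in \<open>J\<close>, either \<open>y\<close> lies in
      \<open>A\<close> and the exchange takes place in \<open>M|A\<close>, or \<open>low\<close>
      applies. For \<open>x\<close> in \<open>C\<close>, the new base still contains
      \<open>J\<close>, which forces \<open>y\<close> outside \<open>A\<close>, and the exchange
      takes place in \<open>M/A\<close>.\<close>
    proof (cases "x \<in> J")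
      case True
      then have xC: "x \<notin> C" using CA JA by blast
      show ?thesis
      proof (cases "y \<in> A")
        case True
        have "insert y (J - {x}) \<in> indeps (restriction M A)"
          using True JA by (auto intro: indep_subset [OF BM])
        then have "insert y (J - {x}) \<in> bases (restriction M A)"
          using J card_exchange [OF JA(2) \<open>x \<in> J\<close>] y by (intro baseI [OF _ J]) auto
        then show ?thesis using exJ \<open>x \<in> J\<close> y by blast
      next
        case False
        then show ?thesis using low [of x y] E JA \<open>x \<in> J\<close> by blast
      qed
    next
      case False
      with x have xC: "x \<in> C" by blast
      then have xA: "x \<notin> A" using CA by blast
      have sub: "J \<subseteq> insert y (C \<union> J - {x})" using False by blast
      have "y \<notin> A" using base_restriction_maximal [OF J BM sub] y by blast
      moreover have "insert y (C \<union> J - {x}) = insert y (C - {x}) \<union> J" using False by blast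
      ultimately have "insert y (C - {x}) \<in> bases (contraction M A)"
        using base_contraction_iff [OF J, of "insert y (C - {x})"] B CA by auto
      then show ?thesis using exC xC y by blast
    qed
  qed
qed

text \<open>By the exchange criterion: exchanges within a summand correspond to exchanges in the
  sum, and there are none across the summands.\<close>

lemma generic_direct_sum_iff:
  "generic (direct_sum M N) f \<longleftrightarrow> generic M (f \<circ> Inl) \<and> generic N (f \<circ> Inr)"
proof
  assume "generic (direct_sum M N) f"
  then obtain B where B: "B \<in> bases (direct_sum M N)"
    and ex: "\<And>x y. x \<in> B \<Longrightarrow> y \<notin> B \<Longrightarrow> insert y (B - {x}) \<in> bases (direct_sum M N) \<Longrightarrow> f x < f y"
    unfolding generic_iff_exchange by blast
  have L: "Inl -` B \<in> bases M" and R: "Inr -` B \<in> bases N"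
    using B base_direct_sum_iff by blast+
  have vL: "Inl -` insert (Inl y) (B - {Inl x}) = insert y (Inl -` B - {x})"
    "Inr -` insert (Inl y) (B - {Inl x}) = Inr -` B" for x y by auto
  have vR: "Inr -` insert (Inr y) (B - {Inr x}) = insert y (Inr -` B - {x})"
    "Inl -` insert (Inr y) (B - {Inr x}) = Inl -` B" for x y by auto
  have "generic M (f \<circ> Inl)"
    unfolding generic_iff_exchange
  proof (intro bexI [OF _ L] ballI allI impI)
    fix x y assume "x \<in> Inl -` B" "y \<notin> Inl -` B" "insert y (Inl -` B - {x}) \<in> bases M"
    then show "(f \<circ> Inl) x < (f \<circ> Inl) y"
      using ex [of "Inl x" "Inl y"] R by (simp add: base_direct_sum_iff vL)
  qed
  moreover have "generic N (f \<circ> Inr)"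
    unfolding generic_iff_exchange
  proof (intro bexI [OF _ R] ballI allI impI)
    fix x y assume "x \<in> Inr -` B" "y \<notin> Inr -` B" "insert y (Inr -` B - {x}) \<in> bases N"
    then show "(f \<circ> Inr) x < (f \<circ> Inr) y"
      using ex [of "Inr x" "Inr y"] L by (simp add: base_direct_sum_iff vR)
  qed
  ultimately show "generic M (f \<circ> Inl) \<and> generic N (f \<circ> Inr)" ..
next
  assume gen: "generic M (f \<circ> Inl) \<and> generic N (f \<circ> Inr)"
  then obtain B where B: "B \<in> bases M"
    and exB: "\<And>x y. x \<in> B \<Longrightarrow> y \<notin> B \<Longrightarrow> insert y (B - {x}) \<in> bases M \<Longrightarrow> f (Inl x) < f (Inl y)"
    unfolding generic_iff_exchange by auto
  from gen obtain C where C: "C \<in> bases N"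
    and exC: "\<And>x y. x \<in> C \<Longrightarrow> y \<notin> C \<Longrightarrow> insert y (C - {x}) \<in> bases N \<Longrightarrow> f (Inr x) < f (Inr y)"
    unfolding generic_iff_exchange by auto
  have v: "Inl -` (B <+> C) = B" "Inr -` (B <+> C) = C" by auto
  have BC: "B <+> C \<in> bases (direct_sum M N)" using B C by (simp add: base_direct_sum_iff v)
  \<comment> \<open>An exchange across the summands would leave a base minus one element as a base
    of its summand.\<close>
  have no_proper: "P - {x} \<notin> bases M'" if "P \<in> bases M'" "x \<in> P" for P x and M' :: "'x matroid"
  proof
    assume "P - {x} \<in> bases M'"
    then have "P = P - {x}" using base_indep [OF that(1)] by (rule base_maximal) blast
    with that(2) show False by blast
  qed
  show "generic (direct_sum M N) f"
    unfolding generic_iff_exchange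
  proof (intro bexI [OF _ BC] ballI allI impI)
    fix x y assume x: "x \<in> B <+> C" and y: "y \<notin> B <+> C"
      and ins: "insert y ((B <+> C) - {x}) \<in> bases (direct_sum M N)"
    note ins' = ins [unfolded base_direct_sum_iff]
    show "f x < f y"
    proof (cases x)
      case x: (Inl a)
      show ?thesis
      proof (cases y)
        case y': (Inl b)
        have "Inl -` insert y ((B <+> C) - {x}) = insert b (B - {a})" using x y' by auto
        then show ?thesis using exB ins' x y' y \<open>x \<in> B <+> C\<close> by auto
      next
        case y': (Inr b)
        have "Inl -` insert y ((B <+> C) - {x}) = B - {a}" using x y' by auto
        then show ?thesis using no_proper [OF B, of a] ins' x \<open>x \<in> B <+> C\<close> by auto
      qed
    next
      case x: (Inr a)
      show ?thesis
      proof (cases y)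
        case y': (Inr b)
        have "Inr -` insert y ((B <+> C) - {x}) = insert b (C - {a})" using x y' by auto
        then show ?thesis using exC ins' x y' y \<open>x \<in> B <+> C\<close> by auto
      next
        case y': (Inl b)
        have "Inr -` insert y ((B <+> C) - {x}) = C - {a}" using x y' by auto
        then show ?thesis using no_proper [OF C, of a] ins' x \<open>x \<in> B <+> C\<close> by auto
      qed
    qed
  qed
qed


section \<open>Monomials of colorings and the product formula\<close>

definition coloring_monom :: "'a set \<Rightarrow> ('a \<Rightarrow> num) \<Rightarrow> num monomial"
  where "coloring_monom E f = (\<Sum>e\<in>E. Poly_Mapping.single (f e) 1)"

lemma coloring_monom_cong:
  "(\<And>e. e \<in> E \<Longrightarrow> f e = g e) \<Longrightarrow> coloring_monom E f = coloring_monom E g"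
  by (simp add: coloring_monom_def)

lemma color_in_keys:
  assumes "finite E" "e \<in> E"
  shows "f e \<in> Poly_Mapping.keys (coloring_monom E f)"
  using assms unfolding coloring_monom_def in_keys_iff lookup_sum_single [OF assms(1)]
  by (auto simp: card_eq_0_iff)

lemma keys_coloring_monom: "Poly_Mapping.keys (coloring_monom E f) \<subseteq> f ` E"
proof (cases "finite E")
  case True
  show ?thesis
  proof
    fix v assume "v \<in> Poly_Mapping.keys (coloring_monom E f)"
    then have "card {e \<in> E. f e = v} \<noteq> 0"
      unfolding coloring_monom_def in_keys_iff lookup_sum_single [OF True] .
    then have "{e \<in> E. f e = v} \<noteq> {}" by (metis card.empty)
    then show "v \<in> f ` E" by auto
  qed
qed (simp add: coloring_monom_def)

lemma rename_coloring_monom: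
  "rename_monom r (coloring_monom E f) = coloring_monom E (\<lambda>e. r (f e))"
proof -
  have "rename_monom r (Poly_Mapping.single v 1) = Poly_Mapping.single (r v) 1" for v
    by (simp add: rename_monom_def)
  then show ?thesis
    unfolding coloring_monom_def
    by (induction E rule: infinite_finite_induct) (simp_all add: rename_monom_add)
qed

definition generic_colorings :: "'a matroid \<Rightarrow> num monomial \<Rightarrow> ('a \<Rightarrow> num) set"
  where "generic_colorings M m =
    {f \<in> ground M \<rightarrow>\<^sub>E UNIV. generic M f \<and> coloring_monom (ground M) f = m}"

lemma coeff_F_series: "coeff (F_series M) m = int (card (generic_colorings M m))"
  by (simp add: F_series.rep_eq generic_colorings_def coloring_monom_def)

lemma finite_generic_colorings [simp]: "finite (generic_colorings M m)"
  using finite_monom_colorings [of M m] by (simp add: generic_colorings_def coloring_monom_def)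

text \<open>A coloring of a disjoint union is a pair of colorings, and monomials multiply
  (additively written).\<close>

lemma F_series_direct_sum: "F_series (direct_sum M N) = F_series M * F_series N"
proof (rule power_series_eqI)
  fix m
  \<comment> \<open>Each pair of colorings carries its pair of monomials, so that the cardinality of
    \<open>?T\<close> is the coefficient of the product.\<close>
  let ?T = "SIGMA p:monom_splits m. generic_colorings M (fst p) \<times> generic_colorings N (snd p)"
  let ?split = "\<lambda>f. ((coloring_monom (ground M) (f \<circ> Inl), coloring_monom (ground N) (f \<circ> Inr)),
    f \<circ> Inl, f \<circ> Inr)"
  have mon: "coloring_monom (ground M <+> ground N) f =
      coloring_monom (ground M) (f \<circ> Inl) + coloring_monom (ground N) (f \<circ> Inr)" for f
    unfolding coloring_monom_def by (simp add: sum.Plus comp_def)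
  have "bij_betw (\<lambda>(_, g, h). case_sum g h) ?T (generic_colorings (direct_sum M N) m)"
  proof (rule bij_betw_byWitness [where f' = ?split])
    show "\<forall>t\<in>?T. ?split ((\<lambda>(_, g, h). case_sum g h) t) = t"
      by (auto simp: generic_colorings_def comp_def)
    show "\<forall>f\<in>generic_colorings (direct_sum M N) m. (\<lambda>(_, g, h). case_sum g h) (?split f) = f"
      by (auto simp: fun_eq_iff split: sum.splits)
    show "(\<lambda>(_, g, h). case_sum g h) ` ?T \<subseteq> generic_colorings (direct_sum M N) m"
      by (auto simp: generic_colorings_def generic_direct_sum_iff mon monom_splits_def
          comp_def PiE_iff extensional_def split: sum.splits)
    show "?split ` generic_colorings (direct_sum M N) m \<subseteq> ?T"
      by (auto simp: generic_colorings_def generic_direct_sum_iff mon monom_splits_def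
          PiE_iff extensional_def)
  qed
  then have "card (generic_colorings (direct_sum M N) m) = card ?T"
    by (rule bij_betw_same_card [symmetric])
  also have "\<dots> = (\<Sum>p\<in>monom_splits m.
      card (generic_colorings M (fst p)) * card (generic_colorings N (snd p)))"
    by (simp add: card_cartesian_product)
  finally show "coeff (F_series (direct_sum M N)) m = coeff (F_series M * F_series N) m"
    by (simp add: times_power_series.rep_eq coeff_F_series split_def)
qed

lemma F_series_empty:
  assumes "ground M = {}"
  shows "F_series M = 1"
proof (rule power_series_eqI)
  fix m
  have "B = {}" if "B \<in> bases M" for B using that base_subset_ground assms by blast
  with bases_nonempty [of M] have "bases M = {{}}" by blast
  then have "generic M f" for f by (auto simp: generic_def)
  \<comment> \<open>On an empty ground set the only extensional coloring is constantly
    \<open>undefined\<close>, and its monomial is the empty product, written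
    \<open>0\<close>.\<close>
  then have "generic_colorings M m = (if m = 0 then {\<lambda>_. undefined} else {})"
    by (auto simp: generic_colorings_def assms coloring_monom_def)
  then show "coeff (F_series M) m = coeff 1 m"
    by (simp add: coeff_F_series one_power_series.rep_eq)
qed

text \<open>Any coloring of a nonempty ground set uses a variable. This gives compatibility with the
  counits.\<close>

lemma coeff_F_series_0: "coeff (F_series M) 0 = (if ground M = {} then 1 else 0)"
proof (cases "ground M = {}")
  case False
  then obtain e where "e \<in> ground M" by blast
  then have "coloring_monom (ground M) f \<noteq> 0" for f
    using color_in_keys [OF finite_ground, of e M f] by auto
  then have "generic_colorings M 0 = {}" by (simp add: generic_colorings_def)
  with False show ?thesis by (simp add: coeff_F_series)
qed (simp add: F_series_empty one_power_series.rep_eq)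

section \<open>Splitting the variables\<close>

lemma less_num_add: "K < K + (j :: num)"
  by (simp add: less_num_def nat_of_num_add nat_of_num_pos)

lemma inj_num_add: "inj ((+) (K :: num))"
  by (rule injI) (simp add: num_eq_iff nat_of_num_add)

lemma range_num_add: "range ((+) K) = {v :: num. K < v}"
proof (intro equalityI subsetI)
  fix v assume "v \<in> {v. K < v}"
  \<comment> \<open>The difference is positive, so \<open>num_of_nat\<close> is a true inverse
    here.\<close>
  then have "v = K + num_of_nat (nat_of_num v - nat_of_num K)"
    by (simp add: num_eq_iff nat_of_num_add less_num_def num_of_nat_inverse)
  then show "v \<in> range ((+) K)" by blast
qed (auto simp: less_num_add)

abbreviation shift_monom :: "num \<Rightarrow> num monomial \<Rightarrow> num monomial"
  where "shift_monom K \<equiv> rename_monom ((+) K)"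

text \<open>Indices up to \<open>K\<close> belong to the first summand and larger ones to the
  shifted summand, so the two can be read off from their sum.\<close>

lemma add_shift_monom_eq_iff:
  assumes "\<And>v. v \<in> Poly_Mapping.keys a \<Longrightarrow> v \<le> K" "\<And>v. v \<in> Poly_Mapping.keys b \<Longrightarrow> v \<le> K"
  shows "a + shift_monom K p = b + shift_monom K q \<longleftrightarrow> a = b \<and> p = q"
proof
  assume eq: "a + shift_monom K p = b + shift_monom K q"
  have "Poly_Mapping.lookup a v = Poly_Mapping.lookup b v" for v
  proof (cases "K < v")
    case True
    then show ?thesis using assms [of v] by (metis in_keys_iff leD)
  next
    case False
    then have "v \<notin> range ((+) K)" by (simp add: range_num_add)
    then show ?thesis
      using arg_cong [OF eq, of "\<lambda>m. Poly_Mapping.lookup m v"]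
      by (simp add: lookup_add lookup_rename_monom_notin)
  qed
  then have "a = b" by (rule poly_mapping_eqI)
  with eq inj_rename_monom [OF inj_num_add] show "a = b \<and> p = q" by (auto dest: injD)
qed simp

text \<open>The shifted variables follow all variables of \<open>m\<close>. The result agrees with
  \<open>exponents_xy_monom\<close>, which lets shifted variables stand for the \<open>y\<close>
  variables.\<close>

lemma exponents_add_shift_monom:
  assumes "\<And>v. v \<in> Poly_Mapping.keys m \<Longrightarrow> v \<le> K"
  shows "exponents (m + shift_monom K n) = exponents m @ exponents n"
proof -
  let ?l = "\<lambda>m :: num monomial. sorted_list_of_set (Poly_Mapping.keys m)"
  have len: "length (?l m) = length (exponents m)" for m
    by (simp add: exponents_def)
  have "m + shift_monom K n = monom_of (?l m @ map ((+) K) (?l n)) (exponents m @ exponents n)"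
    unfolding monom_of_append [OF len] by (simp add: monom_of_exponents rename_monom_exponents)
  also have "exponents \<dots> = exponents m @ exponents n"
  proof (rule exponents_monom_of)
    have s: "sorted_wrt (<) (?l m)" for m
      by (simp add: strict_sorted_iff)
    have lt: "i < j \<longleftrightarrow> K + i < K + j" for i j
      by (simp add: less_num_def nat_of_num_add)
    have "sorted_wrt (<) (map ((+) K) (?l n))"
      using s [of n] by (simp add: sorted_wrt_map flip: lt)
    then show "sorted_wrt (<) (?l m @ map ((+) K) (?l n))"
      using s [of m] assms by (auto simp: sorted_wrt_append intro: le_less_trans less_num_add)
  qed (use exponents_pos [of m] exponents_pos [of n] in \<open>auto simp flip: len\<close>)
  finally show ?thesis .
qed

text \<open>If \<open>K\<close> bounds the indices in \<open>m\<close>, replacing \<open>y\<^sub>j\<close> by \<open>x\<^bsub>K+j\<^esub>\<close> keeps the order of the variables, so that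
  coefficients of \<open>g(x, y)\<close> are coefficients of \<open>g(x)\<close>.\<close>

lemma coeff_xy_extension:
  assumes "\<And>v. v \<in> Poly_Mapping.keys m \<Longrightarrow> v \<le> K"
  shows "coeff (xy_extension g) (xy_monom m n) = coeff (series_of_qsym g) (m + shift_monom K n)"
proof -
  have "coeff (xy_extension g) (xy_monom m n)
      = coeff (xy_extension g) (rename_monom xvar (m + shift_monom K n))"
    by (rule coeff_exponents_cong [OF xy_extension(1)])
      (simp add: exponents_xy_monom exponents_add_shift_monom assms)
  also have "\<dots> = coeff (set_y_zero (xy_extension g)) (m + shift_monom K n)"
    by (simp add: set_y_zero.rep_eq)
  finally show ?thesis by (simp add: xy_extension)
qed

section \<open>The coproduct formula on colorings\<close>

text \<open>A coloring is cut at the threshold \<open>K\<close>: the colors on the set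
  \<open>A\<close> of elements up to \<open>K\<close> give \<open>m\<close>, the others, lowered by
  \<open>K\<close>, give \<open>n\<close>. By \<open>generic_split\<close> this matches generic
  colorings with pairs of generic colorings of \<open>M|A\<close> and \<open>M/A\<close>.\<close>

lemma coeff_F_series_add_shift_monom:
  assumes K: "\<And>v. v \<in> Poly_Mapping.keys m \<Longrightarrow> v \<le> K"
  shows "coeff (F_series M) (m + shift_monom K n) = (\<Sum>A\<in>Pow (ground M).
    coeff (F_series (restriction M A)) m * coeff (F_series (contraction M A)) n)"
proof -
  let ?E = "ground M"
  let ?T = "SIGMA A:Pow ?E. generic_colorings (restriction M A) m \<times> generic_colorings (contraction M A) n"
  let ?S = "generic_colorings M (m + shift_monom K n)"
  let ?join = "\<lambda>(A, g, h). restrict (\<lambda>e. if e \<in> A then g e else K + h e) ?E"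
  let ?low = "\<lambda>f. {e \<in> ?E. f e \<le> K}"
  \<comment> \<open>\<open>inv ((+) K)\<close> subtracts \<open>K\<close> from colors above
    \<open>K\<close>.\<close>
  let ?hi = "\<lambda>f. restrict (\<lambda>e. inv ((+) K) (f e)) (?E - ?low f)"
  let ?split = "\<lambda>f. (?low f, restrict f (?low f), ?hi f)"
  have hi: "K + ?hi f e = f e" if "e \<in> ?E - ?low f" for f e
    using that f_inv_into_f [of "f e" "(+) K" UNIV] by (auto simp: range_num_add)
  have mon: "coloring_monom ?E f = coloring_monom A g + shift_monom K (coloring_monom (?E - A) h)"
    if "A \<subseteq> ?E" "\<And>e. e \<in> A \<Longrightarrow> f e = g e" "\<And>e. e \<in> ?E - A \<Longrightarrow> f e = K + h e" for f A g h
  proof -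
    have "coloring_monom ?E f = coloring_monom A f + coloring_monom (?E - A) f"
      unfolding coloring_monom_def by (simp add: sum.subset_diff [OF that(1)] add.commute)
    also have "coloring_monom A f = coloring_monom A g"
      by (rule coloring_monom_cong) (rule that(2))
    also have "coloring_monom (?E - A) f = shift_monom K (coloring_monom (?E - A) h)"
      unfolding rename_coloring_monom by (rule coloring_monom_cong) (rule that(3))
    finally show ?thesis .
  qed
  have T: "A \<subseteq> ?E \<and> g \<in> A \<rightarrow>\<^sub>E UNIV \<and> h \<in> (?E - A) \<rightarrow>\<^sub>E UNIV \<and>
      generic (restriction M A) g \<and> generic (contraction M A) h \<and>
      coloring_monom A g = m \<and> coloring_monom (?E - A) h = n" if "(A, g, h) \<in> ?T" for A g h
    using that by (auto simp: generic_colorings_def Int_absorb1)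
  \<comment> \<open>Every color of \<open>g\<close> occurs in \<open>m\<close>, whose indices are
    bounded by \<open>K\<close>.\<close>
  have le: "g e \<le> K" if "(A, g, h) \<in> ?T" "e \<in> A" for A g h e
    using K [of "g e"] color_in_keys [of A e g] T [OF that(1)] that(2)
    by (auto intro: finite_subset [OF _ finite_ground])
  have "bij_betw ?join ?T ?S"
  proof (rule bij_betw_byWitness [where f' = ?split])
    show "\<forall>t\<in>?T. ?split (?join t) = t"
    proof
      fix t assume "t \<in> ?T"
      moreover obtain A g h where Agh: "t = (A, g, h)" by (cases t)
      ultimately have t: "(A, g, h) \<in> ?T" by simp
      define f where "f = ?join (A, g, h)"
      have A: "A \<subseteq> ?E" using T [OF t] by blast
      \<comment> \<open>Colors on \<open>A\<close> are at most \<open>K\<close> and colors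
        \<open>K + h e\<close> exceed it, so the threshold recovers \<open>A\<close>.\<close>
      have low: "?low f = A"
        using A le [OF t] less_le_not_le [of K "K + j" for j] less_num_add [of K]
        by (auto simp: f_def split: if_splits)
      moreover have "restrict f A = g"
        using T [OF t] by (intro ext) (auto simp: f_def restrict_def PiE_iff extensional_def)
      moreover have "?hi f = h"
        unfolding low using T [OF t]
        by (intro ext) (auto simp: f_def restrict_def PiE_iff extensional_def inv_f_f [OF inj_num_add])
      ultimately show "?split (?join t) = t"
        unfolding Agh f_def [symmetric] by simp
    qed
    show "\<forall>f\<in>?S. ?join (?split f) = f"
    proof
      fix f assume f: "f \<in> ?S"
      show "?join (?split f) = f"
      proof
        fix e
        show "?join (?split f) e = f e"
        proof (cases "e \<in> ?E")
          case True
          then show ?thesis using hi [of e f] by (cases "f e \<le> K") auto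
        next
          case False
          then show ?thesis using f by (auto simp: generic_colorings_def PiE_iff extensional_def)
        qed
      qed
    qed
    show "?join ` ?T \<subseteq> ?S"
    proof (rule image_subsetI)
      fix t assume t: "t \<in> ?T"
      obtain A g h where Agh: "t = (A, g, h)" by (cases t)
      note T' = T [OF t [unfolded Agh]] and le' = le [OF t [unfolded Agh]]
      define f where "f = ?join t"
      have fg: "f e = g e" if "e \<in> A" for e
        using that T' by (auto simp: f_def Agh)
      have fh: "f e = K + h e" if "e \<in> ?E - A" for e
        using that by (auto simp: f_def Agh)
      have "generic M f"
      proof (subst generic_split [where A = A])
        show "f x < f y" if "x \<in> ?E \<inter> A" "y \<in> ?E - A" for x y
          using that le' [of x] less_num_add [of K "h y"] by (auto simp: fg fh)
        have "generic (restriction M A) f"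
          by (rule generic_cong [of _ g]) (use T' fg in auto)
        moreover have "generic (contraction M A) f"
          by (rule generic_cong [of _ h]) (use T' fh in \<open>auto simp: less_num_def nat_of_num_add\<close>)
        ultimately show "generic (restriction M A) f \<and> generic (contraction M A) f" ..
      qed
      moreover have "coloring_monom ?E f = m + shift_monom K n"
        using mon [of A f g h] fg fh T' by auto
      ultimately show "?join t \<in> ?S" by (auto simp: generic_colorings_def f_def Agh)
    qed
    show "?split ` ?S \<subseteq> ?T"
    proof (rule image_subsetI)
      fix f assume f: "f \<in> ?S"
      let ?g = "restrict f (?low f)"
      have gen: "generic (restriction M (?low f)) f \<and> generic (contraction M (?low f)) f"
        using f by (subst generic_split [symmetric]) (auto simp: generic_colorings_def)
      have E: "?E \<inter> ?low f = ?low f" by blast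
      have "generic (restriction M (?low f)) ?g"
        by (rule generic_cong [of _ f]) (use gen in auto)
      moreover have "generic (contraction M (?low f)) (?hi f)"
      proof (rule generic_cong [of _ f])
        fix x y assume "x \<in> ground (contraction M (?low f))" "y \<in> ground (contraction M (?low f))" "f x < f y"
        then show "?hi f x < ?hi f y"
          using hi [of x f] hi [of y f] by (simp add: less_num_def) (metis add_less_cancel_left nat_of_num_add)
      qed (use gen in blast)
      moreover have "coloring_monom (?low f) ?g = m \<and> coloring_monom (?E - ?low f) (?hi f) = n"
      \<comment> \<open>Only the combined monomial of \<open>f\<close> is given; the bound
        \<open>K\<close> separates its two parts.\<close>
      proof (subst add_shift_monom_eq_iff [symmetric, of _ K])
        show "v \<le> K" if "v \<in> Poly_Mapping.keys (coloring_monom (?low f) ?g)" for v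
          using that keys_coloring_monom [of "?low f" ?g] by auto
        show "coloring_monom (?low f) ?g + shift_monom K (coloring_monom (?E - ?low f) (?hi f))
            = m + shift_monom K n"
        proof (subst mon [symmetric])
          show "f e = K + ?hi f e" if "e \<in> ?E - ?low f" for e
            using hi [OF that] by (rule sym)
        qed (use f in \<open>auto simp: generic_colorings_def\<close>)
      qed (rule K)
      ultimately show "?split f \<in> ?T" by (simp add: generic_colorings_def E)
    qed
  qed
  then have "card ?S = card ?T" by (rule bij_betw_same_card [symmetric])
  also have "\<dots> = (\<Sum>A\<in>Pow ?E. card (generic_colorings (restriction M A) m)
      * card (generic_colorings (contraction M A) n))"
    by (simp add: card_cartesian_product)
  finally show ?thesis by (simp add: coeff_F_series)
qed

lemma xy_extension_matroid_F:
  "xy_extension (matroid_F M) = (\<Sum>A\<in>Pow (ground M).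
    xy_product (matroid_F (restriction M A)) (matroid_F (contraction M A)))"
proof (rule power_series_eqI)
  fix u
  obtain m n where u: "u = xy_monom m n" using ex_xy_monom by blast
  \<comment> \<open>Inserting \<open>num.One\<close> keeps the set nonempty when
    \<open>m = 0\<close>.\<close>
  let ?K = "Max (insert num.One (Poly_Mapping.keys m))"
  have "v \<le> ?K" if "v \<in> Poly_Mapping.keys m" for v
    using that by (intro Max_ge) auto
  then show "coeff (xy_extension (matroid_F M)) u = coeff (\<Sum>A\<in>Pow (ground M).
      xy_product (matroid_F (restriction M A)) (matroid_F (contraction M A))) u"
    unfolding u by (simp add: coeff_xy_extension [of m ?K] series_of_matroid_F
        coeff_F_series_add_shift_monom coeff_sum coeff_xy_mult)
qed

section \<open>The Hopf algebra morphism\<close>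

text \<open>By \<open>ex1_qsym_comult\<close> the tensor is the same for all representations, so any
  convenient one computes the coproduct.\<close>

lemma qsym_comult_eq_sum_list:
  assumes "xy_extension g = (\<Sum>(a, b)\<leftarrow>ghs. xy_product a b)"
  shows "qsym_comult g = (\<Sum>(a, b)\<leftarrow>ghs. a \<otimes> b)"
  unfolding qsym_comult_def by (rule the1_equality [OF ex1_qsym_comult]) (use assms in blast)

lemma qsym_comult_matroid_F:
  "qsym_comult (matroid_F M) =
    (\<Sum>A\<in>Pow (ground M). matroid_F (restriction M A) \<otimes> matroid_F (contraction M A))"
proof -
  \<comment> \<open>Representations are lists of pairs, so the subsets are enumerated without
    repetition.\<close>
  obtain As where As: "set As = Pow (ground M)" "distinct As"
    using finite_distinct_list [of "Pow (ground M)"] by auto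
  let ?ghs = "map (\<lambda>A. (matroid_F (restriction M A), matroid_F (contraction M A))) As"
  have "qsym_comult (matroid_F M) = (\<Sum>(a, b)\<leftarrow>?ghs. a \<otimes> b)"
    by (rule qsym_comult_eq_sum_list)
      (use As in \<open>simp add: xy_extension_matroid_F comp_def flip: sum_list_distinct_conv_sum_set As(1)\<close>)
  then show ?thesis
    using As by (simp add: comp_def flip: sum_list_distinct_conv_sum_set As(1))
qed

text \<open>Uniqueness of the extension makes \<open>xy_extension\<close> additive; concatenated
  representations then represent the sum.\<close>

lemma additive_qsym_comult: "additive qsym_comult"
proof
  fix f g
  have "xy_extension (f + g) = xy_extension f + xy_extension g"
    unfolding xy_extension_def [of "f + g"]
  proof (rule the1_equality [OF ex1_xy_extension], intro conjI)
    show "quasisymmetric (xy_extension f + xy_extension g)"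
      by (intro quasisymmetric_add xy_extension)
    have "set_y_zero (a + b) = set_y_zero a + set_y_zero b" for a b
      by transfer simp
    then show "set_y_zero (xy_extension f + xy_extension g) = series_of_qsym (f + g)"
      by (simp add: xy_extension plus_qsym.rep_eq)
  qed
  moreover obtain ghs where ghs: "xy_extension f = (\<Sum>(a, b)\<leftarrow>ghs. xy_product a b)"
    using ex1_qsym_comult [of f] by blast
  moreover obtain ghs' where ghs': "xy_extension g = (\<Sum>(a, b)\<leftarrow>ghs'. xy_product a b)"
    using ex1_qsym_comult [of g] by blast
  ultimately have "xy_extension (f + g) = (\<Sum>(a, b)\<leftarrow>ghs @ ghs'. xy_product a b)"
    by simp
  from qsym_comult_eq_sum_list [OF this] qsym_comult_eq_sum_list [OF ghs]
    qsym_comult_eq_sum_list [OF ghs']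
  show "qsym_comult (f + g) = qsym_comult f + qsym_comult g" by simp
qed

section \<open>Reduction from the free module to matroid classes\<close>

text \<open>The classes generate \<open>mat\<close> as an abelian group, and each of them is
  represented by a matroid on natural numbers.\<close>

lemma additive_eq_on_mclass:
  assumes "additive f" "additive g"
    and "\<And>M :: nat matroid. f (frag_of (mclass M)) = g (frag_of (mclass M))"
  shows "f (a :: mat) = g a"
  using subset_UNIV [of "Poly_Mapping.keys a"]
proof (induction a rule: frag_induction)
  case zero
  show ?case by (simp only: additive.zero [OF assms(1)] additive.zero [OF assms(2)])
next
  case (one c)
  have "f (frag_of c) = g (frag_of c)"
    by (induction c) (simp only: assms(3) flip: mclass_nat)
  then show ?case .
next
  case (diff a b)
  then show ?case by (simp only: additive.diff [OF assms(1)] additive.diff [OF assms(2)])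
qed

lemma additive_F_map: "additive F_map"
  unfolding F_map_def by (rule free_extend.additive_axioms)

lemma additive_mat_comult: "additive mat_comult"
  unfolding mat_comult_def by (rule free_extend.additive_axioms)

lemma additive_comp: "additive f \<Longrightarrow> additive g \<Longrightarrow> additive (\<lambda>x. f (g x))"
  by (simp add: additive_def)

lemma additive_ident: "additive (\<lambda>x. x)"
  by (simp add: additive_def)

lemma additive_tensor_map: "additive \<phi> \<Longrightarrow> additive \<psi> \<Longrightarrow> additive (tensor_map \<phi> \<psi>)"
  unfolding tensor_map_def by (intro additive_tensor_lift biadditive_tensor_map)

lemma additive_tensor_mult: "additive (tensor_mult :: ('a::ring, 'a) tensor \<Rightarrow> 'a)"
  unfolding tensor_mult_def
  by (intro additive_tensor_lift) (simp add: biadditive_def additive_def distrib_left distrib_right)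

lemma matroid_F_empty: "ground M = {} \<Longrightarrow> matroid_F M = 1"
  by (simp add: series_of_qsym_inject [symmetric] series_of_matroid_F F_series_empty one_qsym.rep_eq)

lemma F_map_1: "F_map 1 = 1"
  unfolding mat_one [where 'a = nat] F_map_mclass by (rule matroid_F_empty) simp

lemma matroid_F_direct_sum: "matroid_F (direct_sum M N) = matroid_F M * matroid_F N"
  by (simp add: series_of_qsym_inject [symmetric] series_of_matroid_F F_series_direct_sum
      times_qsym.rep_eq)

text \<open>Both sides are additive in each argument, so the reduction to classes is applied first
  to \<open>a\<close>, then to \<open>b\<close>.\<close>

lemma F_map_mult: "F_map (a * b) = F_map a * F_map b"
proof (rule additive_eq_on_mclass [of "\<lambda>a. F_map (a * b)" "\<lambda>a. F_map a * F_map b"])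
  fix M :: "nat matroid"
  show "F_map (frag_of (mclass M) * b) = F_map (frag_of (mclass M)) * F_map b"
  proof (rule additive_eq_on_mclass [of "\<lambda>b. F_map (frag_of (mclass M) * b)"])
    fix N :: "nat matroid"
    show "F_map (frag_of (mclass M) * frag_of (mclass N))
        = F_map (frag_of (mclass M)) * F_map (frag_of (mclass N))"
      unfolding frag_of_mclass_mult F_map_mclass by (rule matroid_F_direct_sum)
  qed (use additive_F_map in \<open>simp_all add: additive_def distrib_left\<close>)
qed (use additive_F_map in \<open>simp_all add: additive_def distrib_right\<close>)

lemma qsym_counit_F_map: "qsym_counit (F_map a) = mat_counit a"
proof (rule additive_eq_on_mclass)
  show "additive (\<lambda>a. qsym_counit (F_map a))"
    unfolding qsym_counit_def by (rule additive_comp [OF additive_coeff_qsym additive_F_map])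
  show "additive mat_counit" by standard (simp add: mat_counit_def lookup_add)
  fix M :: "nat matroid"
  show "qsym_counit (F_map (frag_of (mclass M))) = mat_counit (frag_of (mclass M))"
    by (simp add: F_map_mclass qsym_counit_def series_of_matroid_F coeff_F_series_0 mat_counit_def
        lookup_single when_def mclass_empty)
qed

lemma qsym_comult_F_map: "qsym_comult (F_map a) = tensor_map F_map F_map (mat_comult a)"
proof (rule additive_eq_on_mclass)
  note tm = additive_tensor_map [OF additive_F_map additive_F_map]
  show "additive (\<lambda>a. qsym_comult (F_map a))"
    by (rule additive_comp [OF additive_qsym_comult additive_F_map])
  show "additive (\<lambda>a. tensor_map F_map F_map (mat_comult a))"
    by (rule additive_comp [OF tm additive_mat_comult])
  fix M :: "nat matroid"
  show "qsym_comult (F_map (frag_of (mclass M)))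
      = tensor_map F_map F_map (mat_comult (frag_of (mclass M)))"
    by (simp add: mat_comult_mclass F_map_mclass qsym_comult_matroid_F additive.sum [OF tm]
        additive_F_map)
qed

section \<open>Compatibility with the antipodes\<close>

lemma F_map_of_int: "F_map (of_int k) = of_int k"
  by (induction k rule: int_induct [where k = 0])
    (simp_all add: additive.add [OF additive_F_map] additive.diff [OF additive_F_map]
      additive.zero [OF additive_F_map] F_map_1)

text \<open>Since \<open>M/E\<close> is empty, the term \<open>A = E\<close> of the antipode equation expresses the value at \<open>[M]\<close>
  through the values at proper restrictions of \<open>M\<close>. This replaces the usual argument by
  associativity of the convolution product.\<close>

lemma left_convolution_inverse_unique:
  fixes f g :: "'a matroid \<Rightarrow> qsym"
  assumes "\<And>M. (\<Sum>A\<in>Pow (ground M). f (restriction M A) * matroid_F (contraction M A))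
      = (\<Sum>A\<in>Pow (ground M). g (restriction M A) * matroid_F (contraction M A))"
  shows "f M = g M"
proof (induction "card (ground M)" arbitrary: M rule: less_induct)
  case less
  have proper: "f (restriction M A) = g (restriction M A)" if "A \<in> Pow (ground M) - {ground M}" for A
    using that by (intro less) (auto intro!: psubset_card_mono)
  have full: "restriction M (ground M) = M"
    by (rule matroid_eqI) (auto dest: indeps_subset_ground)
  have "matroid_F (contraction M (ground M)) = 1"
    by (rule matroid_F_empty) simp
  with assms [of M] show ?case
    by (simp add: sum.remove [of "Pow (ground M)" "ground M"] full proper)
qed

text \<open>On matroids, \<open>F_map \<circ> S\<close> and \<open>S' \<circ> F_map\<close> are both
  left convolution inverses of \<open>matroid_F\<close>, hence equal.\<close>

lemma F_map_antipode:
  assumes S: "is_antipode mat_comult mat_counit S" and S': "is_antipode qsym_comult qsym_counit S'"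
  shows "F_map (S a) = S' (F_map a)"
proof (rule additive_eq_on_mclass)
  have add: "additive S" "additive S'" using S S' by (simp_all add: is_antipode_def)
  show "additive (\<lambda>a. F_map (S a))" "additive (\<lambda>a. S' (F_map a))"
    by (rule additive_comp [OF additive_F_map add(1)], rule additive_comp [OF add(2) additive_F_map])
  fix M :: "nat matroid"
  show "F_map (S (frag_of (mclass M))) = S' (F_map (frag_of (mclass M)))"
    unfolding F_map_mclass
  proof (rule left_convolution_inverse_unique [where M = M])
    fix M :: "nat matroid"
    \<comment> \<open>The antipode equation of \<open>S\<close> is carried to quasisymmetric
      functions by the ring morphism \<open>F_map\<close>.\<close>
    have "F_map (tensor_mult (tensor_map S (\<lambda>x. x) (mat_comult (frag_of (mclass M)))))
        = F_map (of_int (mat_counit (frag_of (mclass M))))"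
      using S by (simp add: is_antipode_def)
    then have "(\<Sum>A\<in>Pow (ground M).
        F_map (S (frag_of (mclass (restriction M A)))) * matroid_F (contraction M A))
        = of_int (mat_counit (frag_of (mclass M)))"
      by (simp add: mat_comult_mclass add additive_ident
          additive.sum [OF additive_tensor_map [OF add(1) additive_ident]]
          additive.sum [OF additive_tensor_mult] additive.sum [OF additive_F_map]
          F_map_mult F_map_mclass F_map_of_int)
    \<comment> \<open>The antipode equation of \<open>S'\<close> at \<open>matroid_F M\<close>,
      expanded by the coproduct formula.\<close>
    moreover have "(\<Sum>A\<in>Pow (ground M). S' (matroid_F (restriction M A)) * matroid_F (contraction M A))
        = of_int (qsym_counit (matroid_F M))"
    proof -
      have "tensor_mult (tensor_map S' (\<lambda>x. x) (qsym_comult (matroid_F M)))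
          = of_int (qsym_counit (matroid_F M))"
        using S' by (simp add: is_antipode_def)
      then show ?thesis
        by (simp add: qsym_comult_matroid_F additive.sum [OF additive_tensor_map [OF add(2) additive_ident]]
            add additive_ident additive.sum [OF additive_tensor_mult])
    qed
    moreover have "qsym_counit (matroid_F M) = mat_counit (frag_of (mclass M))"
      using qsym_counit_F_map [of "frag_of (mclass M)"] by (simp add: F_map_mclass)
    ultimately show "(\<Sum>A\<in>Pow (ground M).
        F_map (S (frag_of (mclass (restriction M A)))) * matroid_F (contraction M A))
        = (\<Sum>A\<in>Pow (ground M). S' (matroid_F (restriction M A)) * matroid_F (contraction M A))"
      by simp
  qed
qed

theorem theorem3p1:
  shows "hopf_morphism mat_comult mat_counit qsym_comult qsym_counit F_map"
  unfolding hopf_morphism_def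
  by (intro conjI allI impI additive_F_map F_map_1 F_map_mult qsym_counit_F_map qsym_comult_F_map
      F_map_antipode)

end
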